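(* Let $k$ be an algebraically closed field of characteristic zero, $G$ a connected linear algebraic group over $k$, $V$ a rational representation of $G$, $R$ a torus of $G$, and $v\in V$. There exists a decomposition $$G = \coprod_{S \subset P(V)} U^v_S$$ into (possibly empty) locally closed subvarieties, indexed by the subsets $S$ of $P(V)$, such that for all $g, g' \in G$ one has $\Xi_{g.v}(R) = \Xi_{g'.v}(R)$ if and only if $g$ and $g'$ are in the same stratum $U^v_S$ of the decomposition. Moreover, there exists a distinguished $S^v \subset P(V)$ such that $U^v_{S^v}$ is a Zariski dense open subscheme of $G$.
   Context: $X(R)$ denotes the character group of $R$, $V = \bigoplus_{\chi} V_\chi$ is the $R$-weight space decomposition, and $P(V) = \{\chi \in X(R) \mid V_\chi \neq 0\}$. For $u \in V$ with weight decomposition $u = \sum_{\chi} u_\chi$, $u_\chi\in V_\chi$, the (GIT) state of $u$ with respect to $R$ is $\Xi_u(R) = \{\chi \in X(R) \mid u_\chi \neq 0\}$. *)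

theory Defs
  imports
    "HOL-Algebra.Group"
    "HOL-Analysis.Abstract_Topology"
    "HOL-Computational_Algebra.Polynomial"
    "HOL-Library.Disjoint_Sets"
begin

section \<open>Affine varieties\<close>

text \<open>
  Over an algebraically closed field, an affine variety (not necessarily irreducible) is a set
  \<open>X\<close> together with a finitely generated algebra \<open>A = k[X]\<close> of \<open>k\<close>-valued functions on \<open>X\<close> such
  that evaluation is a bijection from \<open>X\<close> onto the set of \<open>k\<close>-algebra homomorphisms \<open>k[X] \<rightarrow> k\<close>.
  Functions on \<open>X\<close> are extensional (\<open>undefined\<close> outside \<open>X\<close>), so that equality of elements of
  \<open>k[X]\<close> is equality on \<open>X\<close>. In characteristic zero every algebraic group is reduced, so nothing
  is lost by working with varieties instead of group schemes.
\<close>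

inductive_set gen_algebra :: "'x set \<Rightarrow> ('x \<Rightarrow> 'k::field) set \<Rightarrow> ('x \<Rightarrow> 'k) set"
  for X :: "'x set" and F :: "('x \<Rightarrow> 'k) set" where
  const: "(\<lambda>x\<in>X. c) \<in> gen_algebra X F"
| gen: "f \<in> F \<Longrightarrow> restrict f X \<in> gen_algebra X F"
| add: "f \<in> gen_algebra X F \<Longrightarrow> g \<in> gen_algebra X F \<Longrightarrow> (\<lambda>x\<in>X. f x + g x) \<in> gen_algebra X F"
| mult: "f \<in> gen_algebra X F \<Longrightarrow> g \<in> gen_algebra X F \<Longrightarrow> (\<lambda>x\<in>X. f x * g x) \<in> gen_algebra X F"

definition algebra_hom :: "'x set \<Rightarrow> ('x \<Rightarrow> 'k::field) set \<Rightarrow> (('x \<Rightarrow> 'k) \<Rightarrow> 'k) \<Rightarrow> bool" where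
  "algebra_hom X A h \<longleftrightarrow>
     (\<forall>c. h (\<lambda>x\<in>X. c) = c) \<and>
     (\<forall>f\<in>A. \<forall>g\<in>A. h (\<lambda>x\<in>X. f x + g x) = h f + h g \<and> h (\<lambda>x\<in>X. f x * g x) = h f * h g)"

definition affine_variety :: "'x set \<Rightarrow> ('x \<Rightarrow> 'k::field) set \<Rightarrow> bool" where
  "affine_variety X A \<longleftrightarrow>
     (\<exists>F. finite F \<and> A = gen_algebra X F) \<and>
     (\<forall>h. algebra_hom X A h \<longrightarrow> (\<exists>!x. x \<in> X \<and> (\<forall>f\<in>A. h f = f x)))"

definition regular_map ::
    "'x set \<Rightarrow> ('x \<Rightarrow> 'k::field) set \<Rightarrow> 'y set \<Rightarrow> ('y \<Rightarrow> 'k) set \<Rightarrow> ('x \<Rightarrow> 'y) \<Rightarrow> bool" where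
  "regular_map X A Y B \<phi> \<longleftrightarrow> \<phi> \<in> X \<rightarrow> Y \<and> (\<forall>f\<in>B. (\<lambda>x\<in>X. f (\<phi> x)) \<in> A)"

text \<open>\<open>k[X \<times> Y]\<close>, which is \<open>k[X] \<otimes> k[Y]\<close> viewed as an algebra of functions on \<open>X \<times> Y\<close>.\<close>

definition prod_regular ::
    "'x set \<Rightarrow> ('x \<Rightarrow> 'k::field) set \<Rightarrow> 'y set \<Rightarrow> ('y \<Rightarrow> 'k) set \<Rightarrow> ('x \<times> 'y \<Rightarrow> 'k) set" where
  "prod_regular X A Y B = gen_algebra (X \<times> Y) ((\<lambda>f. f \<circ> fst) ` A \<union> (\<lambda>g. g \<circ> snd) ` B)"

text \<open>\<open>k[Z]\<close> for a closed subvariety \<open>Z\<close>.\<close>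

definition restr_regular :: "('x \<Rightarrow> 'k::field) set \<Rightarrow> 'x set \<Rightarrow> ('x \<Rightarrow> 'k) set" where
  "restr_regular A Z = (\<lambda>f. restrict f Z) ` A"

text \<open>The closed sets are the zero loci of sets of regular functions; here the open complements.\<close>

definition zariski :: "'x set \<Rightarrow> ('x \<Rightarrow> 'k::field) set \<Rightarrow> 'x topology" where
  "zariski X A = topology (\<lambda>U. \<exists>F\<subseteq>A. U = {x \<in> X. \<exists>f\<in>F. f x \<noteq> 0})"

lemma istopology_zariski:
  assumes "A = gen_algebra X F0"
  shows "istopology (\<lambda>U. \<exists>F\<subseteq>A. U = {x \<in> X. \<exists>f\<in>F. f x \<noteq> 0})"
  unfolding istopology_def
proof (intro conjI allI impI)
  fix S T
  assume "\<exists>F\<subseteq>A. S = {x \<in> X. \<exists>f\<in>F. f x \<noteq> 0}" "\<exists>F\<subseteq>A. T = {x \<in> X. \<exists>f\<in>F. f x \<noteq> 0}"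
  then obtain F H where F: "F \<subseteq> A" "S = {x \<in> X. \<exists>f\<in>F. f x \<noteq> 0}"
    and H: "H \<subseteq> A" "T = {x \<in> X. \<exists>f\<in>H. f x \<noteq> 0}"
    by blast
  let ?P = "(\<lambda>(f, g). \<lambda>x\<in>X. f x * g x) ` (F \<times> H)"
  have "?P \<subseteq> A"
    using F(1) H(1) assms by (auto intro!: gen_algebra.mult)
  moreover have "S \<inter> T = {x \<in> X. \<exists>f\<in>?P. f x \<noteq> 0}"
    using F(2) H(2) by fastforce
  ultimately show "\<exists>F\<subseteq>A. S \<inter> T = {x \<in> X. \<exists>f\<in>F. f x \<noteq> 0}"
    by blast
next
  fix \<U>
  assume "\<forall>U\<in>\<U>. \<exists>F\<subseteq>A. U = {x \<in> X. \<exists>f\<in>F. f x \<noteq> 0}"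
  then have "\<forall>U. \<exists>F. U \<in> \<U> \<longrightarrow> F \<subseteq> A \<and> U = {x \<in> X. \<exists>f\<in>F. f x \<noteq> 0}"
    by blast
  then obtain \<F> where \<F>: "\<forall>U. U \<in> \<U> \<longrightarrow> \<F> U \<subseteq> A \<and> U = {x \<in> X. \<exists>f\<in>\<F> U. f x \<noteq> 0}"
    by (rule exE[OF choice])
  have mem: "x \<in> U \<longleftrightarrow> x \<in> X \<and> (\<exists>f\<in>\<F> U. f x \<noteq> 0)" if "U \<in> \<U>" for x U
    using arg_cong[OF conjunct2[OF \<F>[rule_format, OF that]], of "\<lambda>W. x \<in> W"]
    unfolding mem_Collect_eq .
  have "x \<in> \<Union>\<U> \<longleftrightarrow> x \<in> X \<and> (\<exists>f\<in>\<Union>(\<F> ` \<U>). f x \<noteq> 0)" for x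
  proof -
    have "x \<in> \<Union>\<U> \<longleftrightarrow> (\<exists>U\<in>\<U>. x \<in> X \<and> (\<exists>f\<in>\<F> U. f x \<noteq> 0))"
      unfolding Union_iff by (rule bex_cong[OF refl mem])
    then show ?thesis
      by blast
  qed
  then have "\<Union>\<U> = {x \<in> X. \<exists>f\<in>\<Union>(\<F> ` \<U>). f x \<noteq> 0}"
    by (simp only: set_eq_iff mem_Collect_eq simp_thms)
  moreover have "\<Union>(\<F> ` \<U>) \<subseteq> A"
    by (rule UN_least) (rule conjunct1[OF \<F>[rule_format]])
  ultimately show "\<exists>F\<subseteq>A. \<Union>\<U> = {x \<in> X. \<exists>f\<in>F. f x \<noteq> 0}"
    by (intro exI[of _ "\<Union>(\<F> ` \<U>)"] conjI)
qed

lemma openin_zariski: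
  assumes "affine_variety X A"
  shows "openin (zariski X A) U \<longleftrightarrow> (\<exists>F\<subseteq>A. U = {x \<in> X. \<exists>f\<in>F. f x \<noteq> 0})"
proof -
  obtain F0 where "A = gen_algebra X F0"
    using assms unfolding affine_variety_def by blast
  from topology_inverse'[OF istopology_zariski[OF this]] show ?thesis
    unfolding zariski_def by simp
qed

lemma topspace_zariski:
  assumes "affine_variety X A"
  shows "topspace (zariski X A) = X"
proof -
  have "(\<lambda>x\<in>X. 1) \<in> A"
    using assms unfolding affine_variety_def by (auto intro: gen_algebra.const)
  moreover have "X = {x \<in> X. \<exists>f\<in>{\<lambda>x\<in>X. 1 :: 'b}. f x \<noteq> 0}"
    by auto
  ultimately have "openin (zariski X A) X"
    unfolding openin_zariski[OF assms] by (meson empty_subsetI insert_subset)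
  then show ?thesis
    unfolding topspace_def openin_zariski[OF assms] by auto
qed

lemma closedin_zariski:
  assumes "affine_variety X A"
  shows "closedin (zariski X A) Z \<longleftrightarrow> (\<exists>F\<subseteq>A. Z = {x \<in> X. \<forall>f\<in>F. f x = 0})"
proof -
  have *: "Z \<subseteq> X \<and> X - Z = {x \<in> X. \<exists>f\<in>F. f x \<noteq> 0} \<longleftrightarrow> Z = {x \<in> X. \<forall>f\<in>F. f x = 0}"
    for F :: "('a \<Rightarrow> 'b) set"
    by (rule iffI; (elim conjE)?; fastforce)
  have "Z \<subseteq> X \<and> (\<exists>F\<subseteq>A. X - Z = {x \<in> X. \<exists>f\<in>F. f x \<noteq> 0}) \<longleftrightarrow>
      (\<exists>F\<subseteq>A. Z \<subseteq> X \<and> X - Z = {x \<in> X. \<exists>f\<in>F. f x \<noteq> 0})"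
    by iprover
  also have "\<dots> \<longleftrightarrow> (\<exists>F\<subseteq>A. Z = {x \<in> X. \<forall>f\<in>F. f x = 0})"
    by (simp only: *)
  finally show ?thesis
    unfolding closedin_def topspace_zariski[OF assms] openin_zariski[OF assms] .
qed

definition locally_closedin :: "'x topology \<Rightarrow> 'x set \<Rightarrow> bool" where
  "locally_closedin T L \<longleftrightarrow> (\<exists>C W. closedin T C \<and> openin T W \<and> L = C \<inter> W)"


section \<open>Linear algebraic groups and tori\<close>

definition linear_algebraic_group ::
    "('g, 'm) monoid_scheme \<Rightarrow> ('g \<Rightarrow> 'k::field) set \<Rightarrow> bool" where
  "linear_algebraic_group G A \<longleftrightarrow>
     group G \<and>
     affine_variety (carrier G) A \<and>
     regular_map (carrier G \<times> carrier G) (prod_regular (carrier G) A (carrier G) A) (carrier G) A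
       (\<lambda>(x, y). x \<otimes>\<^bsub>G\<^esub> y) \<and>
     regular_map (carrier G) A (carrier G) A (\<lambda>x. inv\<^bsub>G\<^esub> x)"

text \<open>The group \<open>G\<^sub>m\<^sup>r\<close> of \<open>r\<close>-tuples of nonzero scalars; its regular functions are the Laurent
  polynomials.\<close>

definition split_torus :: "nat \<Rightarrow> (nat \<Rightarrow> 'k::field) monoid" where
  "split_torus r =
     \<lparr>carrier = {..<r} \<rightarrow>\<^sub>E (UNIV - {0}),
      monoid.mult = (\<lambda>s t. \<lambda>i\<in>{..<r}. s i * t i),
      one = (\<lambda>i\<in>{..<r}. 1)\<rparr>"

definition split_torus_regular :: "nat \<Rightarrow> ((nat \<Rightarrow> 'k::field) \<Rightarrow> 'k) set" where
  "split_torus_regular r =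
     gen_algebra (carrier (split_torus r))
       ((\<lambda>i t. t i) ` {..<r} \<union> (\<lambda>i t. inverse (t i)) ` {..<r})"

text \<open>A torus of \<open>G\<close> is a closed subgroup that is isomorphic, as an algebraic group, to some
  \<open>G\<^sub>m\<^sup>r\<close>.\<close>

definition torus_of ::
    "('g, 'm) monoid_scheme \<Rightarrow> ('g \<Rightarrow> 'k::field) set \<Rightarrow> 'g set \<Rightarrow> bool" where
  "torus_of G A R \<longleftrightarrow>
     subgroup R G \<and>
     closedin (zariski (carrier G) A) R \<and>
     (\<exists>r \<phi>. \<phi> \<in> iso (G\<lparr>carrier := R\<rparr>) (split_torus r :: (nat \<Rightarrow> 'k) monoid) \<and>
        regular_map R (restr_regular A R) (carrier (split_torus r)) (split_torus_regular r) \<phi> \<and>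
        regular_map (carrier (split_torus r)) (split_torus_regular r) R (restr_regular A R)
          (inv_into R \<phi>))"

text \<open>The character group \<open>X(R)\<close>, as a set: homomorphisms of algebraic groups \<open>R \<rightarrow> G\<^sub>m\<close>. Regularity
  of \<open>1 / \<chi>\<close> need not be demanded, since \<open>1 / \<chi>\<close> is \<open>\<chi>\<close> composed with inversion.\<close>

definition characters ::
    "('g, 'm) monoid_scheme \<Rightarrow> ('g \<Rightarrow> 'k::field) set \<Rightarrow> 'g set \<Rightarrow> ('g \<Rightarrow> 'k) set" where
  "characters G A R =
     {\<chi> \<in> restr_regular A R.
        (\<forall>r\<in>R. \<chi> r \<noteq> 0) \<and> (\<forall>r\<in>R. \<forall>s\<in>R. \<chi> (r \<otimes>\<^bsub>G\<^esub> s) = \<chi> r * \<chi> s)}"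


section \<open>Rational representations, weights and states\<close>

text \<open>
  A finite-dimensional vector space \<open>V\<close> (the whole type \<open>'v\<close>, with scalar multiplication \<open>scale\<close>)
  and a homomorphism of algebraic groups \<open>\<rho> : G \<rightarrow> GL(V)\<close>. Regularity is the condition that all
  matrix coefficients are regular functions on \<open>G\<close>; regularity of \<open>1 / det (\<rho> g)\<close> is then automatic
  because it equals \<open>det (\<rho> (inv g))\<close>.
\<close>

definition rational_representation ::
    "('g, 'm) monoid_scheme \<Rightarrow> ('g \<Rightarrow> 'k::field) set \<Rightarrow> ('k \<Rightarrow> 'v::ab_group_add \<Rightarrow> 'v) \<Rightarrow>
     ('g \<Rightarrow> 'v \<Rightarrow> 'v) \<Rightarrow> bool" where
  "rational_representation G A scale \<rho> \<longleftrightarrow>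
     vector_space scale \<and>
     (\<exists>B. finite B \<and> module.span scale B = UNIV) \<and>
     (\<forall>g\<in>carrier G. Vector_Spaces.linear scale scale (\<rho> g)) \<and>
     (\<forall>u. \<rho> \<one>\<^bsub>G\<^esub> u = u) \<and>
     (\<forall>g\<in>carrier G. \<forall>h\<in>carrier G. \<forall>u. \<rho> (g \<otimes>\<^bsub>G\<^esub> h) u = \<rho> g (\<rho> h u)) \<and>
     (\<forall>l u. Vector_Spaces.linear scale (*) l \<longrightarrow> (\<lambda>g\<in>carrier G. l (\<rho> g u)) \<in> A)"

definition weight_space ::
    "('k::field \<Rightarrow> 'v::ab_group_add \<Rightarrow> 'v) \<Rightarrow> ('g \<Rightarrow> 'v \<Rightarrow> 'v) \<Rightarrow> 'g set \<Rightarrow> ('g \<Rightarrow> 'k) \<Rightarrow> 'v set" where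
  "weight_space scale \<rho> R \<chi> = {u. \<forall>r\<in>R. \<rho> r u = scale (\<chi> r) u}"

definition weights ::
    "('g, 'm) monoid_scheme \<Rightarrow> ('g \<Rightarrow> 'k::field) set \<Rightarrow> ('k \<Rightarrow> 'v::ab_group_add \<Rightarrow> 'v) \<Rightarrow>
     ('g \<Rightarrow> 'v \<Rightarrow> 'v) \<Rightarrow> 'g set \<Rightarrow> ('g \<Rightarrow> 'k) set" where
  "weights G A scale \<rho> R = {\<chi> \<in> characters G A R. weight_space scale \<rho> R \<chi> \<noteq> {0}}"

definition weight_decomposition ::
    "('g, 'm) monoid_scheme \<Rightarrow> ('g \<Rightarrow> 'k::field) set \<Rightarrow> ('k \<Rightarrow> 'v::ab_group_add \<Rightarrow> 'v) \<Rightarrow>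
     ('g \<Rightarrow> 'v \<Rightarrow> 'v) \<Rightarrow> 'g set \<Rightarrow> 'v \<Rightarrow> (('g \<Rightarrow> 'k) \<Rightarrow> 'v) \<Rightarrow> bool" where
  "weight_decomposition G A scale \<rho> R u c \<longleftrightarrow>
     (\<forall>\<chi>\<in>characters G A R. c \<chi> \<in> weight_space scale \<rho> R \<chi>) \<and>
     (\<forall>\<chi>. \<chi> \<notin> characters G A R \<longrightarrow> c \<chi> = 0) \<and>
     finite {\<chi>. c \<chi> \<noteq> 0} \<and>
     u = (\<Sum>\<chi> | c \<chi> \<noteq> 0. c \<chi>)"

text \<open>The component \<open>u\<^sub>\<chi>\<close>. The description is proper when \<open>R\<close> is a torus: then \<open>V\<close> is the direct sum
  of its weight spaces.\<close>

definition weight_component ::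
    "('g, 'm) monoid_scheme \<Rightarrow> ('g \<Rightarrow> 'k::field) set \<Rightarrow> ('k \<Rightarrow> 'v::ab_group_add \<Rightarrow> 'v) \<Rightarrow>
     ('g \<Rightarrow> 'v \<Rightarrow> 'v) \<Rightarrow> 'g set \<Rightarrow> 'v \<Rightarrow> ('g \<Rightarrow> 'k) \<Rightarrow> 'v" where
  "weight_component G A scale \<rho> R u = (THE c. weight_decomposition G A scale \<rho> R u c)"

definition state ::
    "('g, 'm) monoid_scheme \<Rightarrow> ('g \<Rightarrow> 'k::field) set \<Rightarrow> ('k \<Rightarrow> 'v::ab_group_add \<Rightarrow> 'v) \<Rightarrow>
     ('g \<Rightarrow> 'v \<Rightarrow> 'v) \<Rightarrow> 'g set \<Rightarrow> 'v \<Rightarrow> ('g \<Rightarrow> 'k) set" where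
  "state G A scale \<rho> R u =
     {\<chi> \<in> characters G A R. weight_component G A scale \<rho> R u \<chi> \<noteq> 0}"

end

theory Submission
  imports Defs "HOL-Library.Function_Algebras"
begin

text \<open>
  The torus \<open>R\<close> acts diagonalizably on \<open>V\<close>, so every vector has a unique decomposition into weight
  components, each component \<open>u\<^sub>\<chi>\<close> depends linearly on \<open>u\<close>, and there are only finitely many
  weights. The stratum of \<open>S\<close> is \<open>{g. \<Xi>\<^sub>g\<^sub>v(R) = S}\<close>. The coordinates of \<open>(g v)\<^sub>\<chi>\<close> are matrix
  coefficients, hence regular functions of \<open>g\<close>; so \<open>D \<chi> = {g. (g v)\<^sub>\<chi> \<noteq> 0}\<close> is open, and a stratum is
  the intersection of the finitely many \<open>D \<chi>\<close> with \<open>\<chi> \<in> S\<close> and of the closed complements of the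
  other \<open>D \<chi>\<close>. The distinguished set consists of those \<open>\<chi>\<close> with \<open>D \<chi> \<noteq> {}\<close>: its stratum is the
  intersection of all nonempty \<open>D \<chi>\<close>, which is open, and it is nonempty and dense because every
  nonempty open subset of a connected algebraic group is dense.

  Two facts carry this. The first, \<open>connected_group_open_dense\<close>, is the irreducibility of connected
  groups. By the Hilbert basis theorem a finitely generated algebra of functions contains no
  infinite family of nonzero functions with pairwise zero products, so some nonempty open set of
  \<open>G\<close> is irreducible (\<open>zariski_irreducible_open_exists\<close>). Its translates cover \<open>G\<close>, and in a space
  covered by irreducible open sets the closure of an open set is again open; connectedness then
  leaves no room for a proper closure.

  The second, \<open>decomposes_exists\<close>, is the diagonalizability of \<open>R\<close>. The coordinate functions of
  \<open>G\<^sub>m\<^sup>r\<close> and their inverses are characters, and products of characters are characters, so every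
  regular function on \<open>R\<close> is a linear combination of characters. Hence \<open>r u = \<Sum> \<chi>(r) w\<^sub>\<chi>\<close> with
  vectors \<open>w\<^sub>\<chi>\<close>, and comparing \<open>s (r u)\<close> with \<open>(s r) u\<close> shows, by the independence of characters,
  that \<open>w\<^sub>\<chi>\<close> is a weight vector.
\<close>

section \<open>The Hilbert basis theorem for subrings\<close>

text \<open>
  Adjoining generators one at a time must stay inside one type, so rings are represented as
  subsets of an ambient commutative ring; below this is the ring of all functions on a type.
\<close>

definition unital_subring :: "'a::comm_ring_1 set \<Rightarrow> bool" where
  "unital_subring B \<longleftrightarrow> 1 \<in> B \<and> (\<forall>x\<in>B. - x \<in> B) \<and>
     (\<forall>x\<in>B. \<forall>y\<in>B. x + y \<in> B \<and> x * y \<in> B)"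

definition ideal_in :: "'a::comm_ring_1 set \<Rightarrow> 'a set \<Rightarrow> bool" where
  "ideal_in B I \<longleftrightarrow> I \<subseteq> B \<and> 0 \<in> I \<and> (\<forall>x\<in>I. \<forall>y\<in>I. x + y \<in> I) \<and> (\<forall>b\<in>B. \<forall>x\<in>I. b * x \<in> I)"

inductive_set ideal_generated :: "'a::comm_ring_1 set \<Rightarrow> 'a set \<Rightarrow> 'a set"
  for B F where
  zero: "0 \<in> ideal_generated B F"
| step: "x \<in> ideal_generated B F \<Longrightarrow> b \<in> B \<Longrightarrow> f \<in> F \<Longrightarrow> b * f + x \<in> ideal_generated B F"

definition noetherian_in :: "'a::comm_ring_1 set \<Rightarrow> bool" where
  "noetherian_in B \<longleftrightarrow>
     (\<forall>I. ideal_in B I \<longrightarrow> (\<exists>F\<subseteq>I. finite F \<and> I \<subseteq> ideal_generated B F))"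

definition adjoin :: "'a::comm_ring_1 set \<Rightarrow> 'a \<Rightarrow> 'a set" where
  "adjoin B x = {poly p x | p. \<forall>i. coeff p i \<in> B}"

lemma unital_subring_zero: "unital_subring B \<Longrightarrow> 0 \<in> B"
  unfolding unital_subring_def by (metis add.right_inverse)

lemma unital_subring_sum:
  assumes "unital_subring B" "\<And>i. i \<in> I \<Longrightarrow> f i \<in> B"
  shows "sum f I \<in> B"
  using assms(2) unital_subring_zero[OF assms(1)] assms(1)
  by (induction I rule: infinite_finite_induct) (auto simp: unital_subring_def)

lemma ideal_generated_add:
  assumes "x \<in> ideal_generated B F" "y \<in> ideal_generated B F"
  shows "x + y \<in> ideal_generated B F"
  using assms(1)
  by induction (auto simp: assms(2) add.assoc intro: ideal_generated.step)

lemma ideal_generated_mult: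
  assumes "unital_subring B" "x \<in> ideal_generated B F" "c \<in> B"
  shows "c * x \<in> ideal_generated B F"
  using assms(2)
proof induction
  case zero
  then show ?case by (simp add: ideal_generated.zero)
next
  case (step x b f)
  have "(c * b) * f + c * x \<in> ideal_generated B F"
    using step assms by (intro ideal_generated.step) (auto simp: unital_subring_def)
  then show ?case by (simp add: algebra_simps)
qed

lemma ideal_generated_base:
  assumes "unital_subring B" "f \<in> F"
  shows "f \<in> ideal_generated B F"
  using ideal_generated.step[OF ideal_generated.zero, of 1 B f F] assms
  by (simp add: unital_subring_def)

lemma ideal_generated_ideal:
  assumes "unital_subring B" "F \<subseteq> B"
  shows "ideal_in B (ideal_generated B F)"
proof -
  have "x \<in> B" if "x \<in> ideal_generated B F" for x
    using that
    by induction (use assms unital_subring_zero in \<open>auto simp: unital_subring_def\<close>)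
  then show ?thesis
    using assms by (auto simp: ideal_in_def ideal_generated.zero
        intro: ideal_generated_add ideal_generated_mult)
qed

lemma ideal_generated_least:
  assumes "ideal_in B I" "F \<subseteq> I"
  shows "ideal_generated B F \<subseteq> I"
proof
  fix x assume "x \<in> ideal_generated B F"
  then show "x \<in> I"
    by induction (use assms in \<open>auto simp: ideal_in_def\<close>)
qed

lemma adjoin_unital_subring:
  assumes B: "unital_subring B"
  shows "unital_subring (adjoin B x)"
proof -
  have "1 \<in> adjoin B x"
    using B unital_subring_zero[OF B] unfolding adjoin_def
    by (intro CollectI exI[of _ 1]) (auto simp: unital_subring_def coeff_1)
  moreover have "- poly p x \<in> adjoin B x" if "\<forall>i. coeff p i \<in> B" for p
    unfolding adjoin_def
    by (intro CollectI exI[of _ "- p"]) (use B that in \<open>auto simp: unital_subring_def\<close>)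
  moreover have "poly p x + poly q x \<in> adjoin B x"
    if "\<forall>i. coeff p i \<in> B" "\<forall>i. coeff q i \<in> B" for p q
    unfolding adjoin_def
    by (intro CollectI exI[of _ "p + q"]) (use B that in \<open>auto simp: unital_subring_def\<close>)
  moreover have "poly p x * poly q x \<in> adjoin B x"
    if "\<forall>i. coeff p i \<in> B" "\<forall>i. coeff q i \<in> B" for p q
    unfolding adjoin_def
    by (intro CollectI exI[of _ "p * q"] conjI)
      (use B that in \<open>auto simp: unital_subring_def coeff_mult intro!: unital_subring_sum\<close>)
  ultimately show ?thesis
    unfolding unital_subring_def adjoin_def by blast
qed

lemma adjoin_base:
  assumes B: "unital_subring B"
  shows "B \<subseteq> adjoin B x" "x \<in> adjoin B x"
proof -
  note z = unital_subring_zero[OF B]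
  show "B \<subseteq> adjoin B x"
    unfolding adjoin_def
    by (intro subsetI CollectI, rule_tac x = "[:xa:]" in exI) (auto simp: coeff_pCons z split: nat.split)
  show "x \<in> adjoin B x"
    unfolding adjoin_def
    by (intro CollectI exI[of _ "[:0, 1:]"])
      (use B in \<open>auto simp: coeff_pCons z unital_subring_def split: nat.split\<close>)
qed

text \<open>
  The usual argument with leading coefficients. The ring generated by \<open>x\<close> over \<open>B\<close> need not be a
  polynomial ring, so the argument is applied to the polynomials over \<open>B\<close> whose value at \<open>x\<close> lies in
  the given ideal. The coefficients at degree \<open>n\<close> of those of degree at most \<open>n\<close> form an ideal \<open>L n\<close>
  of \<open>B\<close>; the chain of the \<open>L n\<close> becomes stationary at some \<open>d\<close>, and polynomials of degree at most
  \<open>d\<close> whose leading coefficients generate \<open>L 0, \<dots>, L d\<close> suffice to lower the degree of any other.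
\<close>

theorem hilbert_basis:
  assumes B: "unital_subring B" and noeth: "noetherian_in B"
  shows "noetherian_in (adjoin B x)"
  unfolding noetherian_in_def
proof (intro allI impI)
  fix I
  let ?C = "adjoin B x"
  assume I: "ideal_in ?C I"
  note C = adjoin_unital_subring[OF B, of x] and z = unital_subring_zero[OF B]
  define J where "J = {p. (\<forall>i. coeff p i \<in> B) \<and> poly p x \<in> I}"
  \<comment> \<open>Degree at most \<open>n\<close>, put in terms of coefficients so that the zero polynomial needs no special case.\<close>
  define J' where "J' n = {p \<in> J. \<forall>i>n. coeff p i = 0}" for n
  define L where "L n = (\<lambda>p. coeff p n) ` J' n" for n
  have J_zero: "0 \<in> J"
    using I z by (auto simp: J_def ideal_in_def)
  have J_add: "p + q \<in> J" if "p \<in> J" "q \<in> J" for p q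
    using that I B by (auto simp: J_def ideal_in_def unital_subring_def)
  have J_smult: "smult b p \<in> J" if "p \<in> J" "b \<in> B" for p b
    using that I B adjoin_base(1)[OF B, of x]
    by (auto simp: J_def ideal_in_def unital_subring_def)
  have J_diff: "p - q \<in> J" if "p \<in> J" "q \<in> J" for p q
    using J_add[OF that(1) J_smult[OF that(2), of "- 1"]] B
    by (auto simp: unital_subring_def)
  have J_shift: "pCons 0 p \<in> J" if "p \<in> J" for p
    using that I z adjoin_base(2)[OF B, of x]
    by (auto simp: J_def ideal_in_def coeff_pCons split: nat.split)
  have L_ideal: "ideal_in B (L n)" for n
    unfolding ideal_in_def
  proof (intro conjI ballI)
    show "L n \<subseteq> B" by (auto simp: L_def J'_def J_def)
    show "0 \<in> L n" using J_zero by (auto simp: L_def J'_def intro!: image_eqI[of _ _ 0])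
    fix a b assume "a \<in> L n"
    then obtain p where p: "p \<in> J' n" "a = coeff p n" by (auto simp: L_def)
    show "a + b \<in> L n" if "b \<in> L n"
    proof -
      obtain q where "q \<in> J' n" "b = coeff q n" using \<open>b \<in> L n\<close> by (auto simp: L_def)
      then show ?thesis
        using p J_add by (auto simp: L_def J'_def intro!: image_eqI[of _ _ "p + q"])
    qed
  next
    fix a b assume "a \<in> L n" "b \<in> B"
    then obtain p where p: "p \<in> J' n" "a = coeff p n" by (auto simp: L_def)
    then show "b * a \<in> L n"
      using \<open>b \<in> B\<close> J_smult by (auto simp: L_def J'_def intro!: image_eqI[of _ _ "smult b p"])
  qed
  have L_Suc: "L n \<subseteq> L (Suc n)" for n
  proof
    fix a assume "a \<in> L n"
    then obtain p where "p \<in> J' n" "a = coeff p n" by (auto simp: L_def)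
    then show "a \<in> L (Suc n)"
      using J_shift by (auto simp: L_def J'_def coeff_pCons split: nat.split
          intro!: image_eqI[of _ _ "pCons 0 p"])
  qed
  have L_mono: "L m \<subseteq> L n" if "m \<le> n" for m n
    using lift_Suc_mono_le[of L, OF L_Suc that] .
  have "ideal_in B (\<Union>n. L n)"
    unfolding ideal_in_def
  proof (intro conjI ballI)
    fix a b assume "a \<in> (\<Union>n. L n)" "b \<in> (\<Union>n. L n)"
    then obtain m n where "a \<in> L m" "b \<in> L n" by auto
    then have "a \<in> L (max m n)" "b \<in> L (max m n)"
      using L_mono[of m "max m n"] L_mono[of n "max m n"] by auto
    then show "a + b \<in> (\<Union>n. L n)"
      using L_ideal[of "max m n"] unfolding ideal_in_def by blast
  qed (insert L_ideal, unfold ideal_in_def, blast+)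
  then obtain F where F: "F \<subseteq> (\<Union>n. L n)" "finite F" "(\<Union>n. L n) \<subseteq> ideal_generated B F"
    using noeth unfolding noetherian_in_def by blast
  have "\<exists>d. F \<subseteq> L d"
    using F(2,1)
  proof induction
    case (insert a F)
    then obtain d n where "F \<subseteq> L d" "a \<in> L n" by auto
    then have "insert a F \<subseteq> L (max d n)"
      using L_mono[of d "max d n"] L_mono[of n "max d n"] by auto
    then show ?case ..
  qed auto
  then obtain d where "F \<subseteq> L d" ..
  with F(3) ideal_generated_least[OF L_ideal] have L_stable: "L n \<subseteq> L d" for n
    by blast
  have "\<exists>Q. Q \<subseteq> J' n \<and> finite Q \<and> L n \<subseteq> ideal_generated B ((\<lambda>p. coeff p n) ` Q)" for n
  proof -
    obtain K where K: "K \<subseteq> L n" "finite K" "L n \<subseteq> ideal_generated B K"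
      using noeth[unfolded noetherian_in_def, rule_format, OF L_ideal] by metis
    from finite_subset_image[OF K(2) K(1)[unfolded L_def]] K(3) show ?thesis
      unfolding L_def by metis
  qed
  then obtain Q where Q: "\<And>n. Q n \<subseteq> J' n" "\<And>n. finite (Q n)"
      "\<And>n. L n \<subseteq> ideal_generated B ((\<lambda>p. coeff p n) ` Q n)"
    by metis
  define E where "E = (\<lambda>p. poly p x) ` (\<Union>m\<le>d. Q m)"
  have lift: "\<exists>q\<in>J' n. coeff q n = c \<and> poly q x \<in> ideal_generated ?C E"
    if "c \<in> ideal_generated B ((\<lambda>p. coeff p n) ` Q n)" "n \<le> d" for c n
    using that(1)
  proof induction
    case zero
    show ?case
      using J_zero by (auto simp: J'_def intro!: bexI[of _ 0] ideal_generated.zero)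
  next
    case (step c b f)
    then obtain q p where q: "q \<in> J' n" "coeff q n = c" "poly q x \<in> ideal_generated ?C E"
      and p: "p \<in> Q n" "f = coeff p n" by auto
    have "b * poly p x + poly q x \<in> ideal_generated ?C E"
      using q(3) step(2) adjoin_base(1)[OF B, of x] p that(2)
      by (intro ideal_generated.step) (auto simp: E_def)
    moreover have "smult b p + q \<in> J' n"
      using q(1) p(1) Q(1)[of n] step(2) J_add J_smult by (auto simp: J'_def)
    ultimately show ?case
      using q p by (intro bexI[of _ "smult b p + q"]) auto
  qed
  \<comment> \<open>Above degree \<open>d\<close>, a polynomial of degree \<open>d\<close> with the right coefficient is multiplied by a power of the variable.\<close>
  have reduce: "\<exists>q\<in>J' n. coeff q n = coeff p n \<and> poly q x \<in> ideal_generated ?C E"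
    if "p \<in> J' n" for p n
  proof (cases "n \<le> d")
    case True
    have "coeff p n \<in> L n" using that by (auto simp: L_def)
    then show ?thesis using lift Q(3) True by blast
  next
    case False
    have "coeff p n \<in> L n" using that by (auto simp: L_def)
    then have "coeff p n \<in> L d" using L_stable by blast
    then obtain q where q: "q \<in> J' d" "coeff q d = coeff p n" "poly q x \<in> ideal_generated ?C E"
      using lift Q(3) by blast
    have "\<exists>q\<in>J' (d + k). coeff q (d + k) = coeff p n \<and> poly q x \<in> ideal_generated ?C E" for k
    proof (induction k)
      case 0
      then show ?case using q by auto
    next
      case (Suc k)
      then obtain q where q: "q \<in> J' (d + k)" "coeff q (d + k) = coeff p n"
          "poly q x \<in> ideal_generated ?C E"
        by auto
      have "x * poly q x \<in> ideal_generated ?C E"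
        by (rule ideal_generated_mult[OF C q(3) adjoin_base(2)[OF B]])
      moreover have "pCons 0 q \<in> J' (d + Suc k)"
        using q(1) J_shift by (auto simp: J'_def coeff_pCons split: nat.split)
      ultimately show ?case
        using q by (intro bexI[of _ "pCons 0 q"]) auto
    qed
    from this[of "n - d"] show ?thesis using False by simp
  qed
  \<comment> \<open>Induction on a strict bound for the degree: subtracting a combination of the generators removes the top term.\<close>
  have gen: "poly p x \<in> ideal_generated ?C E" if "p \<in> J" "\<forall>i\<ge>n. coeff p i = 0" for p n
    using that
  proof (induction n arbitrary: p)
    case 0
    then have "p = 0" by (simp add: poly_eq_iff)
    then show ?case by (simp add: ideal_generated.zero)
  next
    case (Suc n)
    then have "p \<in> J' n" by (auto simp: J'_def)
    from reduce[OF this] obtain q where q: "q \<in> J' n" "coeff q n = coeff p n"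
        "poly q x \<in> ideal_generated ?C E"
      by blast
    have "poly (p - q) x \<in> ideal_generated ?C E"
    proof (rule Suc.IH)
      show "p - q \<in> J" using Suc.prems q(1) J_diff by (auto simp: J'_def)
      show "\<forall>i\<ge>n. coeff (p - q) i = 0"
        using q \<open>p \<in> J' n\<close> by (auto simp: J'_def le_less)
    qed
    from ideal_generated_add[OF this q(3)] show ?case by simp
  qed
  show "\<exists>F\<subseteq>I. finite F \<and> I \<subseteq> ideal_generated ?C F"
  proof (intro exI[of _ E] conjI)
    show "E \<subseteq> I" using Q(1) by (force simp: E_def J'_def J_def)
    show "finite E" using Q(2) by (simp add: E_def)
    show "I \<subseteq> ideal_generated ?C E"
    proof
      fix a assume "a \<in> I"
      with I have "a \<in> ?C" by (auto simp: ideal_in_def)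
      then obtain p where "a = poly p x" "\<forall>i. coeff p i \<in> B" by (auto simp: adjoin_def)
      with \<open>a \<in> I\<close> gen[of p "Suc (degree p)"] show "a \<in> ideal_generated ?C E"
        by (auto simp: J_def coeff_eq_0)
    qed
  qed
qed

text \<open>
  The functions here are total. Constants are then a copy of the field that contains the unit of
  the function ring, which fails for functions that are \<open>undefined\<close> outside a set.
\<close>

lemma noetherian_function_subring:
  fixes F :: "('x \<Rightarrow> 'k::field) set"
  assumes "finite F"
  shows "\<exists>C. unital_subring C \<and> noetherian_in C \<and> range (\<lambda>c x. c) \<subseteq> C \<and> F \<subseteq> C"
  using assms
proof induction
  case empty
  let ?K = "range (\<lambda>c x. c) :: ('x \<Rightarrow> 'k) set"
  have "noetherian_in ?K"
    unfolding noetherian_in_def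
  proof (intro allI impI)
    fix I assume I: "ideal_in ?K I"
    show "\<exists>F\<subseteq>I. finite F \<and> I \<subseteq> ideal_generated ?K F"
    proof (cases "I \<subseteq> {0}")
      case True
      then show ?thesis by (intro exI[of _ "{}"]) (auto intro: ideal_generated.zero)
    next
      case False
      then obtain c where c: "(\<lambda>x. c) \<in> I" "c \<noteq> 0"
        using I by (fastforce simp: ideal_in_def zero_fun_def)
      have "(\<lambda>x. e) \<in> ideal_generated ?K {\<lambda>x. c}" for e
        using ideal_generated.step[OF ideal_generated.zero, of "\<lambda>x. e / c" ?K "\<lambda>x. c" "{\<lambda>x. c}"] c(2)
        by (simp add: times_fun_def)
      with c I show ?thesis by (intro exI[of _ "{\<lambda>x. c}"]) (auto simp: ideal_in_def)
    qed
  qed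
  moreover have "unital_subring ?K"
    unfolding unital_subring_def by (auto simp: one_fun_def fun_Compl_def plus_fun_def times_fun_def)
  ultimately show ?case by blast
next
  case (insert f F)
  then obtain C where C: "unital_subring C" "noetherian_in C" "range (\<lambda>c x. c) \<subseteq> C" "F \<subseteq> C"
    by blast
  then show ?case
    using adjoin_unital_subring[OF C(1), of f] hilbert_basis[OF C(1,2), of f] adjoin_base[OF C(1), of f]
    by (intro exI[of _ "adjoin C f"]) auto
qed

text \<open>
  This transfers the noetherian property to functions on \<open>X\<close>, as \<open>restrict\<close> maps \<open>C\<close> onto a set
  that contains the generated algebra.
\<close>

lemma gen_algebra_lift:
  assumes C: "unital_subring C" "range (\<lambda>c x. c) \<subseteq> C" "F \<subseteq> C" and "f \<in> gen_algebra X F"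
  shows "\<exists>h\<in>C. f = restrict h X"
  using assms(4)
proof induction
  case (const c)
  then show ?case using C(2) by (intro bexI[of _ "\<lambda>x. c"]) auto
next
  case (add f g)
  then obtain a b where "a \<in> C" "b \<in> C" "f = restrict a X" "g = restrict b X" by blast
  with C(1) show ?case
    by (intro bexI[of _ "a + b"]) (auto simp: unital_subring_def restrict_def)
next
  case (mult f g)
  then obtain a b where "a \<in> C" "b \<in> C" "f = restrict a X" "g = restrict b X" by blast
  with C(1) show ?case
    by (intro bexI[of _ "a * b"]) (auto simp: unital_subring_def restrict_def)
qed (use C in auto)

text \<open>
  A finite set of generators of the ideal spanned by all \<open>f n\<close> involves only finitely many of them.
  Any later \<open>f n\<close> therefore annihilates the ideal, of which it is itself a member, so its square
  vanishes.
\<close>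

lemma no_infinite_orthogonal_family:
  assumes "finite F" and f: "\<And>n::nat. f n \<in> gen_algebra X F"
    and orth: "\<And>m n x. m \<noteq> n \<Longrightarrow> x \<in> X \<Longrightarrow> f m x * f n x = 0"
  shows "\<exists>n. \<forall>x\<in>X. f n x = 0"
proof -
  obtain C where C: "unital_subring C" "noetherian_in C" "range (\<lambda>c x. c) \<subseteq> C" "F \<subseteq> C"
    using noetherian_function_subring[OF assms(1)] by blast
  have "\<exists>h\<in>C. f n = restrict h X" for n
    by (rule gen_algebra_lift[OF C(1,3,4) f])
  then obtain h where h: "\<And>n. h n \<in> C" "\<And>n. f n = restrict (h n) X" by metis
  have "ideal_in C (ideal_generated C (range h))"
    by (rule ideal_generated_ideal[OF C(1)]) (use h in auto)
  then obtain E where E: "E \<subseteq> ideal_generated C (range h)" "finite E"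
      "ideal_generated C (range h) \<subseteq> ideal_generated C E"
    using C(2) unfolding noetherian_in_def by blast
  have ann: "\<exists>N. \<forall>n\<ge>N. \<forall>x\<in>X. a x * h n x = 0" if "a \<in> ideal_generated C (range h)" for a
    using that
  proof induction
    case (step a b k)
    then obtain N m where N: "\<forall>n\<ge>N. \<forall>x\<in>X. a x * h n x = 0" and m: "k = h m" by auto
    have "(b * k + a) x * h n x = 0" if "n \<ge> max N (Suc m)" "x \<in> X" for n x
      using N that orth[of m n x] m by (auto simp: h(2) algebra_simps)
    then show ?case by blast
  qed auto
  have "\<exists>N. \<forall>n\<ge>N. \<forall>a\<in>E. \<forall>x\<in>X. a x * h n x = 0"
    using E(2,1)
  proof induction
    case (insert a E)
    then obtain M N where "\<forall>n\<ge>N. \<forall>a\<in>E. \<forall>x\<in>X. a x * h n x = 0" "\<forall>n\<ge>M. \<forall>x\<in>X. a x * h n x = 0"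
      using ann[of a] by auto
    then show ?case by (intro exI[of _ "max M N"]) auto
  qed auto
  then obtain n where n: "\<forall>a\<in>E. \<forall>x\<in>X. a x * h n x = 0" by blast
  have *: "\<forall>x\<in>X. a x * h n x = 0" if "a \<in> ideal_generated C E" for a
    using that by induction (use n in \<open>auto simp: algebra_simps\<close>)
  have "h n \<in> ideal_generated C E"
    using E(3) ideal_generated_base[OF C(1), of "h n" "range h"] by auto
  from *[OF this] show ?thesis by (auto simp: h(2))
qed

section \<open>Irreducibility of connected algebraic groups\<close>

definition irreducible_open :: "'x topology \<Rightarrow> 'x set \<Rightarrow> bool" where
  "irreducible_open T W \<longleftrightarrow> openin T W \<and> W \<noteq> {} \<and>
     (\<forall>U V. openin T U \<longrightarrow> openin T V \<longrightarrow> U \<inter> W \<noteq> {} \<longrightarrow> V \<inter> W \<noteq> {} \<longrightarrow> U \<inter> V \<inter> W \<noteq> {})"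

text \<open>
  If no open set is irreducible, every nonempty open set contains two disjoint nonempty open
  subsets. Keeping one and splitting the other again, forever, yields infinitely many disjoint ones.
\<close>

lemma irreducible_open_exists:
  assumes "topspace T \<noteq> {}"
    and finitary: "\<And>D::nat \<Rightarrow> 'x set. (\<And>n. openin T (D n)) \<Longrightarrow> disjoint_family D \<Longrightarrow> \<exists>n. D n = {}"
  shows "\<exists>W. irreducible_open T W"
proof (rule ccontr)
  assume no: "\<nexists>W. irreducible_open T W"
  define P where "P U \<longleftrightarrow> openin T U \<and> U \<noteq> {}" for U :: "'x set"
  have "\<exists>V W. P V \<and> P W \<and> V \<subseteq> U \<and> W \<subseteq> U \<and> V \<inter> W = {}" if "P U" for U
  proof -
    obtain V W where "openin T V" "openin T W" "V \<inter> U \<noteq> {}" "W \<inter> U \<noteq> {}" "V \<inter> W \<inter> U = {}"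
    proof -
      have "\<not> irreducible_open T U" using no by simp
      with \<open>P U\<close> that show thesis unfolding irreducible_open_def P_def by metis
    qed
    then show ?thesis
      using \<open>P U\<close> unfolding P_def
      by (intro exI[of _ "V \<inter> U"] exI[of _ "W \<inter> U"]) auto
  qed
  then obtain a b where ab: "\<And>U. P U \<Longrightarrow> P (a U) \<and> P (b U) \<and> a U \<subseteq> U \<and> b U \<subseteq> U \<and> a U \<inter> b U = {}"
    by metis
  define U where "U n = (b ^^ n) (topspace T)" for n
  have PU: "P (U n)" for n
    using assms(1) ab by (induction n) (auto simp: U_def P_def)
  have "U (Suc n) \<subseteq> U n" for n
    using ab[OF PU[of n]] by (simp add: U_def)
  then have U_mono: "U n \<subseteq> U m" if "m \<le> n" for m n
    using lift_Suc_antimono_le[of U] that by blast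
  have disj: "a (U m) \<inter> a (U n) = {}" if "m < n" for m n
  proof -
    have "a (U n) \<subseteq> U (Suc m)"
      using U_mono[of "Suc m" n] that ab[OF PU[of n]] by auto
    then show ?thesis
      using ab[OF PU[of m]] by (auto simp: U_def)
  qed
  have "disjoint_family (\<lambda>n. a (U n))"
    unfolding disjoint_family_on_def
    by (metis disj inf_commute nat_neq_iff)
  then show False
    using finitary[of "\<lambda>n. a (U n)"] ab[OF PU] unfolding P_def by blast
qed

text \<open>
  If \<open>x\<close> lies in the closure of \<open>U\<close>, an irreducible open neighbourhood \<open>W\<close> of \<open>x\<close> meets \<open>U\<close>; then
  any open set that meets \<open>W\<close> also meets \<open>U\<close>, so that \<open>W\<close> lies in the closure as well. Thus the
  closure is open and closed.
\<close>

lemma connected_locally_irreducible_dense: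
  assumes conn: "connected_space T"
    and loc: "\<And>x. x \<in> topspace T \<Longrightarrow> \<exists>W. irreducible_open T W \<and> x \<in> W"
    and U: "openin T U" "U \<noteq> {}"
  shows "T closure_of U = topspace T"
proof -
  have "openin T (T closure_of U)"
  proof (subst openin_subopen, intro ballI)
    fix x assume x: "x \<in> T closure_of U"
    then obtain W where W: "irreducible_open T W" "x \<in> W"
      using loc in_closure_of by metis
    then have "openin T W" "U \<inter> W \<noteq> {}"
      using x by (auto simp: irreducible_open_def in_closure_of)
    moreover have "W \<subseteq> T closure_of U"
    proof
      fix y assume "y \<in> W"
      then have "N \<inter> U \<noteq> {}" if "openin T N" "y \<in> N" for N
        using W(1) U(1) \<open>U \<inter> W \<noteq> {}\<close> that unfolding irreducible_open_def by blast
      then show "y \<in> T closure_of U"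
        using \<open>y \<in> W\<close> \<open>openin T W\<close> openin_subset by (fastforce simp: in_closure_of)
    qed
    ultimately show "\<exists>S. openin T S \<and> x \<in> S \<and> S \<subseteq> T closure_of U"
      using W(2) by blast
  qed
  moreover have "T closure_of U \<noteq> {}"
    using U closure_of_subset[OF openin_subset[OF U(1)]] by auto
  ultimately show ?thesis
    using conn closedin_closure_of unfolding connected_space_clopen_in by blast
qed

text \<open>
  Nonzero functions whose nonvanishing loci lie in disjoint open sets have zero product.
\<close>

lemma zariski_irreducible_open_exists:
  assumes X: "affine_variety X A" and "X \<noteq> {}"
  shows "\<exists>W. irreducible_open (zariski X A) W"
proof (rule irreducible_open_exists)
  show "topspace (zariski X A) \<noteq> {}"
    using assms by (simp add: topspace_zariski)
next
  fix D :: "nat \<Rightarrow> 'a set"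
  assume D: "\<And>n. openin (zariski X A) (D n)" and disj: "disjoint_family D"
  obtain F where F: "finite F" "A = gen_algebra X F"
    using X unfolding affine_variety_def by blast
  show "\<exists>n. D n = {}"
  proof (rule ccontr)
    assume "\<nexists>n. D n = {}"
    have "\<exists>f\<in>A. {x \<in> X. f x \<noteq> 0} \<subseteq> D n \<and> (\<exists>x\<in>X. f x \<noteq> 0)" for n
    proof -
      obtain H where H: "H \<subseteq> A" "D n = {x \<in> X. \<exists>f\<in>H. f x \<noteq> 0}"
        using D[of n] unfolding openin_zariski[OF X] by blast
      moreover have "D n \<noteq> {}" using \<open>\<nexists>n. D n = {}\<close> by blast
      ultimately show ?thesis by blast
    qed
    then obtain f where f: "\<And>n. f n \<in> A" "\<And>n. {x \<in> X. f n x \<noteq> 0} \<subseteq> D n"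
        "\<And>n. \<exists>x\<in>X. f n x \<noteq> 0"
      by metis
    have "f m x * f n x = 0" if "m \<noteq> n" "x \<in> X" for m n x
    proof -
      have "D m \<inter> D n = {}" using disj that(1) by (simp add: disjoint_family_on_def)
      then show ?thesis using f(2)[of m] f(2)[of n] that(2) by auto
    qed
    then have "\<exists>n. \<forall>x\<in>X. f n x = 0"
      using no_infinite_orthogonal_family[OF F(1), of f X] f(1) F(2) by blast
    then show False using f(3) by blast
  qed
qed

lemma prod_regular_slice:
  assumes B: "B = gen_algebra Y H" and f: "f \<in> prod_regular X A Y B" and x: "x \<in> X"
  shows "(\<lambda>y\<in>Y. f (x, y)) \<in> B"
  using f unfolding prod_regular_def
proof induction
  case (const c)
  have "(\<lambda>y\<in>Y. (\<lambda>z\<in>X \<times> Y. c) (x, y)) = (\<lambda>y\<in>Y. c)"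
    using x by (auto simp: restrict_def)
  then show ?case unfolding B by (simp only: gen_algebra.const)
next
  case (gen f)
  then consider a where "a \<in> A" "f = a \<circ> fst" | b where "b \<in> B" "f = b \<circ> snd" by blast
  then show ?case
  proof cases
    case 1
    then have "(\<lambda>y\<in>Y. restrict f (X \<times> Y) (x, y)) = (\<lambda>y\<in>Y. a x)"
      using x by (auto simp: restrict_def)
    then show ?thesis unfolding B by (simp only: gen_algebra.const)
  next
    case 2
    have "b = restrict b Y"
      using 2(1) unfolding B by (cases rule: gen_algebra.cases) (auto simp: restrict_def)
    moreover have "(\<lambda>y\<in>Y. restrict f (X \<times> Y) (x, y)) = restrict b Y"
      using 2 x by (auto simp: restrict_def)
    ultimately show ?thesis using 2(1) by metis
  qed
next
  case (add f g)
  have "(\<lambda>y\<in>Y. (\<lambda>z\<in>X \<times> Y. f z + g z) (x, y))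
      = (\<lambda>y\<in>Y. (\<lambda>y\<in>Y. f (x, y)) y + (\<lambda>y\<in>Y. g (x, y)) y)"
    using x by (auto simp: restrict_def)
  then show ?case using gen_algebra.add[OF add.IH[unfolded B]] unfolding B by (simp only:)
next
  case (mult f g)
  have "(\<lambda>y\<in>Y. (\<lambda>z\<in>X \<times> Y. f z * g z) (x, y))
      = (\<lambda>y\<in>Y. (\<lambda>y\<in>Y. f (x, y)) y * (\<lambda>y\<in>Y. g (x, y)) y)"
    using x by (auto simp: restrict_def)
  then show ?case using gen_algebra.mult[OF mult.IH[unfolded B]] unfolding B by (simp only:)
qed

lemma openin_zariski_preimage:
  assumes X: "affine_variety X A" and Y: "affine_variety Y B" and \<phi>: "regular_map X A Y B \<phi>"
    and U: "openin (zariski Y B) U"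
  shows "openin (zariski X A) {x \<in> X. \<phi> x \<in> U}"
proof -
  obtain H where H: "H \<subseteq> B" "U = {y \<in> Y. \<exists>f\<in>H. f y \<noteq> 0}"
    using U unfolding openin_zariski[OF Y] by blast
  have "(\<lambda>f. \<lambda>x\<in>X. f (\<phi> x)) ` H \<subseteq> A"
    using \<phi> H(1) by (auto simp: regular_map_def)
  moreover have "{x \<in> X. \<phi> x \<in> U} = {x \<in> X. \<exists>f\<in>(\<lambda>f. \<lambda>x\<in>X. f (\<phi> x)) ` H. f x \<noteq> 0}"
    using \<phi> H(2) by (auto simp: regular_map_def)
  ultimately show ?thesis
    unfolding openin_zariski[OF X] by blast
qed

lemma translation_regular:
  assumes G: "linear_algebraic_group G A" and h: "h \<in> carrier G"
  shows "regular_map (carrier G) A (carrier G) A (\<lambda>x. h \<otimes>\<^bsub>G\<^esub> x)"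
proof -
  obtain F where F: "A = gen_algebra (carrier G) F"
    using G by (auto simp: linear_algebraic_group_def affine_variety_def)
  interpret group G using G by (simp add: linear_algebraic_group_def)
  have "(\<lambda>x\<in>carrier G. f (h \<otimes>\<^bsub>G\<^esub> x)) \<in> A" if "f \<in> A" for f
  proof -
    have "(\<lambda>p\<in>carrier G \<times> carrier G. f (case p of (x, y) \<Rightarrow> x \<otimes>\<^bsub>G\<^esub> y))
        \<in> prod_regular (carrier G) A (carrier G) A" (is "?f \<in> _")
      using G that by (auto simp: linear_algebraic_group_def regular_map_def)
    from prod_regular_slice[OF F this h]
    have "(\<lambda>y\<in>carrier G. ?f (h, y)) \<in> A" .
    moreover have "(\<lambda>y\<in>carrier G. ?f (h, y)) = (\<lambda>y\<in>carrier G. f (h \<otimes>\<^bsub>G\<^esub> y))"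
      using h by (auto simp: restrict_def)
    ultimately show ?thesis by simp
  qed
  then show ?thesis using h by (auto simp: regular_map_def)
qed

lemma irreducible_open_translate:
  assumes G: "linear_algebraic_group G A" and h: "h \<in> carrier G"
    and W: "irreducible_open (zariski (carrier G) A) W"
  shows "irreducible_open (zariski (carrier G) A) {x \<in> carrier G. h \<otimes>\<^bsub>G\<^esub> x \<in> W}"
proof -
  let ?T = "zariski (carrier G) A" and ?pre = "\<lambda>h U. {x \<in> carrier G. h \<otimes>\<^bsub>G\<^esub> x \<in> U}"
  interpret group G using G by (simp add: linear_algebraic_group_def)
  have aff: "affine_variety (carrier G) A" using G by (simp add: linear_algebraic_group_def)
  have open_pre: "openin ?T (?pre k U)" if "k \<in> carrier G" "openin ?T U" for k U
    by (rule openin_zariski_preimage[OF aff aff translation_regular[OF G that(1)] that(2)])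
  have meets: "x \<in> U \<inter> ?pre h W \<longleftrightarrow> h \<otimes>\<^bsub>G\<^esub> x \<in> ?pre (inv\<^bsub>G\<^esub> h) U \<inter> W" if "x \<in> carrier G" for x U
    using h that by (auto simp: m_assoc[symmetric])
  have sub: "U \<subseteq> carrier G" if "openin ?T U" for U
    using openin_subset[OF that] topspace_zariski[OF aff] by simp
  have pt: "\<exists>x\<in>carrier G. y = h \<otimes>\<^bsub>G\<^esub> x" if "y \<in> carrier G" for y
    using h that by (intro bexI[of _ "inv\<^bsub>G\<^esub> h \<otimes>\<^bsub>G\<^esub> y"]) (auto simp: m_assoc[symmetric])
  have in_nonempty: "a \<in> Y \<Longrightarrow> Y \<noteq> {}" for a :: 'a and Y by auto
  have W': "openin ?T W" "W \<noteq> {}"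
    "\<And>U V. openin ?T U \<Longrightarrow> openin ?T V \<Longrightarrow> U \<inter> W \<noteq> {} \<Longrightarrow> V \<inter> W \<noteq> {} \<Longrightarrow> U \<inter> V \<inter> W \<noteq> {}"
    using W unfolding irreducible_open_def by blast+
  show ?thesis
    unfolding irreducible_open_def
  proof (intro conjI allI impI)
    show "openin ?T (?pre h W)" using open_pre h W'(1) by blast
    show "?pre h W \<noteq> {}"
      using W'(2) sub[OF W'(1)] pt by blast
    fix U V assume U: "openin ?T U" and V: "openin ?T V"
      and m: "U \<inter> ?pre h W \<noteq> {}" "V \<inter> ?pre h W \<noteq> {}"
    from h have h': "inv\<^bsub>G\<^esub> h \<in> carrier G" by simp
    obtain x where "x \<in> carrier G" "x \<in> U \<inter> ?pre h W" using m(1) by auto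
    from meets[THEN iffD1, OF this] have "?pre (inv\<^bsub>G\<^esub> h) U \<inter> W \<noteq> {}"
      by (rule in_nonempty)
    moreover obtain x where "x \<in> carrier G" "x \<in> V \<inter> ?pre h W" using m(2) by auto
    from meets[THEN iffD1, OF this] have "?pre (inv\<^bsub>G\<^esub> h) V \<inter> W \<noteq> {}"
      by (rule in_nonempty)
    ultimately have "?pre (inv\<^bsub>G\<^esub> h) U \<inter> ?pre (inv\<^bsub>G\<^esub> h) V \<inter> W \<noteq> {}"
      by (rule W'(3)[OF open_pre[OF h' U] open_pre[OF h' V]])
    then obtain y where y: "y \<in> carrier G" "y \<in> ?pre (inv\<^bsub>G\<^esub> h) U \<inter> W"
        "y \<in> ?pre (inv\<^bsub>G\<^esub> h) V \<inter> W"
      by auto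
    obtain x where x: "x \<in> carrier G" "y = h \<otimes>\<^bsub>G\<^esub> x" using pt[OF y(1)] by auto
    have "x \<in> U \<inter> ?pre h W" "x \<in> V \<inter> ?pre h W"
      using y(2,3) by (simp_all only: x(2) meets[OF x(1)])
    then show "U \<inter> V \<inter> ?pre h W \<noteq> {}" by auto
  qed
qed

theorem connected_group_open_dense:
  assumes G: "linear_algebraic_group G A" and conn: "connected_space (zariski (carrier G) A)"
    and U: "openin (zariski (carrier G) A) U" "U \<noteq> {}"
  shows "zariski (carrier G) A closure_of U = carrier G"
proof -
  let ?T = "zariski (carrier G) A"
  interpret group G using G by (simp add: linear_algebraic_group_def)
  have aff: "affine_variety (carrier G) A" using G by (simp add: linear_algebraic_group_def)
  have top: "topspace ?T = carrier G" by (rule topspace_zariski[OF aff])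
  \<comment> \<open>One irreducible open set suffices: the left translate that moves \<open>w\<close> to \<open>x\<close> is a neighbourhood of \<open>x\<close>.\<close>
  obtain W where W: "irreducible_open ?T W"
    using zariski_irreducible_open_exists[OF aff] by blast
  then have "W \<noteq> {}" "W \<subseteq> carrier G"
    using openin_subset[of ?T W] top by (auto simp: irreducible_open_def)
  then obtain w where w: "w \<in> W" "w \<in> carrier G"
    by blast
  have "\<exists>W. irreducible_open ?T W \<and> x \<in> W" if "x \<in> topspace ?T" for x
    using irreducible_open_translate[OF G _ W, of "w \<otimes>\<^bsub>G\<^esub> inv\<^bsub>G\<^esub> x"] w that top
    by (auto simp: m_assoc)
  from connected_locally_irreducible_dense[OF conn this U] show ?thesis
    using top by simp
qed

section \<open>Regular functions on a torus are sums of characters\<close>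

text \<open>
  The coefficients \<open>w\<close> are vectors, so that scalar functions on \<open>R\<close> and orbit maps into \<open>V\<close> are
  covered alike.
\<close>

definition character_sum ::
    "('k::field \<Rightarrow> 'v::ab_group_add \<Rightarrow> 'v) \<Rightarrow> 'x set \<Rightarrow> ('x \<Rightarrow> 'k) set \<Rightarrow> ('x \<Rightarrow> 'v) \<Rightarrow> bool" where
  "character_sum scale R K F \<longleftrightarrow>
     (\<exists>C w. finite C \<and> C \<subseteq> K \<and> (\<forall>r\<in>R. F r = (\<Sum>\<chi>\<in>C. scale (\<chi> r) (w \<chi>))))"

context vector_space
begin

lemma character_sum_zero: "character_sum scale R K (\<lambda>r. 0)"
  unfolding character_sum_def by (intro exI[of _ "{}"]) auto

lemma character_sum_single: "\<chi> \<in> K \<Longrightarrow> character_sum scale R K (\<lambda>r. scale (\<chi> r) w)"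
  unfolding character_sum_def by (intro exI[of _ "{\<chi>}"] exI[of _ "\<lambda>_. w"]) auto

lemma character_sum_eqI:
  assumes "character_sum scale R K F" "\<And>r. r \<in> R \<Longrightarrow> H r = F r"
  shows "character_sum scale R K H"
  using assms unfolding character_sum_def by simp

lemma character_sum_add:
  assumes "character_sum scale R K F" "character_sum scale R K H"
  shows "character_sum scale R K (\<lambda>r. F r + H r)"
proof -
  obtain C w where C: "finite C" "C \<subseteq> K" "\<forall>r\<in>R. F r = (\<Sum>\<chi>\<in>C. scale (\<chi> r) (w \<chi>))"
    using assms(1) unfolding character_sum_def by (elim exE conjE) (rule that)
  obtain D z where D: "finite D" "D \<subseteq> K" "\<forall>r\<in>R. H r = (\<Sum>\<chi>\<in>D. scale (\<chi> r) (z \<chi>))"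
    using assms(2) unfolding character_sum_def by (elim exE conjE) (rule that)
  have pad: "(\<Sum>\<chi>\<in>E. scale (\<chi> r) (y \<chi>)) = (\<Sum>\<chi>\<in>C \<union> D. scale (\<chi> r) (if \<chi> \<in> E then y \<chi> else 0))"
    if "E \<subseteq> C \<union> D" for E r and y :: "('c \<Rightarrow> 'a) \<Rightarrow> 'b"
    using C(1) D(1) that by (intro sum.mono_neutral_cong_left) auto
  have "F r + H r = (\<Sum>\<chi>\<in>C \<union> D. scale (\<chi> r)
      ((if \<chi> \<in> C then w \<chi> else 0) + (if \<chi> \<in> D then z \<chi> else 0)))" if "r \<in> R" for r
    unfolding scale_right_distrib sum.distrib
    using C(3) D(3) pad[of C r w] pad[of D r z] that by simp
  then show ?thesis
    unfolding character_sum_def using C(1,2) D(1,2)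
    by (intro exI[of _ "C \<union> D"]
        exI[of _ "\<lambda>\<chi>. (if \<chi> \<in> C then w \<chi> else 0) + (if \<chi> \<in> D then z \<chi> else 0)"]) simp
qed

lemma character_sum_sum:
  assumes "\<And>i. i \<in> J \<Longrightarrow> character_sum scale R K (F i)"
  shows "character_sum scale R K (\<lambda>r. \<Sum>i\<in>J. F i r)"
  using assms
  by (induction J rule: infinite_finite_induct)
    (auto simp: character_sum_zero intro: character_sum_add)

end

lemma vector_space_field: "vector_space ((*) :: 'k::field \<Rightarrow> 'k \<Rightarrow> 'k)"
  by unfold_locales (auto simp: algebra_simps)

lemma character_sum_mult:
  fixes f g :: "'x \<Rightarrow> 'k::field"
  assumes "character_sum (*) R K f" "character_sum (*) R K g"
    and K: "\<And>\<chi> \<psi>. \<chi> \<in> K \<Longrightarrow> \<psi> \<in> K \<Longrightarrow> (\<lambda>r\<in>R. \<chi> r * \<psi> r) \<in> K"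
  shows "character_sum (*) R K (\<lambda>r. f r * g r)"
proof -
  interpret vector_space "(*) :: 'k \<Rightarrow> 'k \<Rightarrow> 'k" by (rule vector_space_field)
  obtain C a where C: "finite C" "C \<subseteq> K" "\<forall>r\<in>R. f r = (\<Sum>\<chi>\<in>C. \<chi> r * a \<chi>)"
    using assms(1) unfolding character_sum_def by (elim exE conjE) (rule that)
  obtain D b where D: "finite D" "D \<subseteq> K" "\<forall>r\<in>R. g r = (\<Sum>\<chi>\<in>D. \<chi> r * b \<chi>)"
    using assms(2) unfolding character_sum_def by (elim exE conjE) (rule that)
  have "character_sum (*) R K
      (\<lambda>r. \<Sum>\<chi>\<in>C. \<Sum>\<psi>\<in>D. (\<lambda>r\<in>R. \<chi> r * \<psi> r) r * (a \<chi> * b \<psi>))"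
    using C(2) D(2) K by (intro character_sum_sum character_sum_single) blast
  moreover have "f r * g r = (\<Sum>\<chi>\<in>C. \<Sum>\<psi>\<in>D. (\<lambda>r\<in>R. \<chi> r * \<psi> r) r * (a \<chi> * b \<psi>))" if "r \<in> R" for r
    unfolding C(3)[rule_format, OF that] D(3)[rule_format, OF that] sum_product
    by (intro sum.cong refl) (simp only: restrict_apply' that ac_simps)
  ultimately show ?thesis
    by (rule character_sum_eqI)
qed

lemma restr_regular_closed:
  assumes A: "A = gen_algebra X F" and "R \<subseteq> X"
  shows "(\<lambda>x\<in>R. c) \<in> restr_regular A R"
    and "\<lbrakk>f \<in> restr_regular A R; g \<in> restr_regular A R\<rbrakk> \<Longrightarrow> (\<lambda>x\<in>R. f x * g x) \<in> restr_regular A R"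
proof -
  show "(\<lambda>x\<in>R. c) \<in> restr_regular A R"
    unfolding restr_regular_def A
    by (rule image_eqI[OF _ gen_algebra.const[of c]]) (use assms(2) in \<open>auto simp: fun_eq_iff\<close>)
  assume "f \<in> restr_regular A R" "g \<in> restr_regular A R"
  then obtain a b where "a \<in> A" "b \<in> A" "f = restrict a R" "g = restrict b R"
    by (auto simp: restr_regular_def)
  then show "(\<lambda>x\<in>R. f x * g x) \<in> restr_regular A R"
    unfolding restr_regular_def A
    by (intro image_eqI[OF _ gen_algebra.mult[of a _ _ b]])
      (use assms(2) in \<open>auto simp: fun_eq_iff\<close>)
qed

text \<open>
  Laurent monomials are characters. Through the isomorphism \<open>\<phi>\<close> the generators of the coordinate ring of
  \<open>G\<^sub>m\<^sup>r\<close> become characters of \<open>R\<close>, and linear combinations of characters form an algebra.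
\<close>

lemma torus_regular_character_sum:
  fixes A :: "('g \<Rightarrow> 'k::field) set"
  assumes G: "linear_algebraic_group G A" and R: "torus_of G A R"
    and f: "f \<in> restr_regular A R"
  shows "character_sum (*) R (characters G A R) f"
proof -
  interpret vector_space "(*) :: 'k \<Rightarrow> 'k \<Rightarrow> 'k" by (rule vector_space_field)
  let ?K = "characters G A R"
  obtain X where A: "A = gen_algebra (carrier G) X"
    using G by (auto simp: linear_algebraic_group_def affine_variety_def)
  have RG: "R \<subseteq> carrier G" using R by (simp add: torus_of_def subgroup.subset)
  note closed = restr_regular_closed[OF A RG]
  obtain n \<phi> where iso: "\<phi> \<in> iso (G\<lparr>carrier := R\<rparr>) (split_torus n :: (nat \<Rightarrow> 'k) monoid)"
    and reg: "regular_map R (restr_regular A R) (carrier (split_torus n)) (split_torus_regular n) \<phi>"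
    and reg': "regular_map (carrier (split_torus n)) (split_torus_regular n) R (restr_regular A R)
          (inv_into R \<phi>)"
    using R unfolding torus_of_def by blast
  let ?T = "carrier (split_torus n) :: (nat \<Rightarrow> 'k) set"
  have bij: "bij_betw \<phi> R ?T" using iso by (simp add: iso_def)
  then have \<phi>T: "\<phi> r \<in> ?T" if "r \<in> R" for r using that by (auto simp: bij_betw_def)
  have hom: "\<phi> (r \<otimes>\<^bsub>G\<^esub> s) = (\<lambda>i\<in>{..<n}. \<phi> r i * \<phi> s i)" if "r \<in> R" "s \<in> R" for r s
    using iso that by (auto simp: iso_def hom_def split_torus_def)
  have nz: "\<phi> r i \<noteq> 0" if "r \<in> R" "i < n" for r i
    using \<phi>T[OF that(1)] that(2) by (auto simp: split_torus_def)
  have closed_R: "r \<otimes>\<^bsub>G\<^esub> s \<in> R" if "r \<in> R" "s \<in> R" for r s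
    using R that by (auto simp: torus_of_def subgroup.m_closed)
  have one: "(\<lambda>r\<in>R. 1) \<in> ?K"
    using closed(1) closed_R by (auto simp: characters_def)
  have prod: "(\<lambda>r\<in>R. \<chi> r * \<psi> r) \<in> ?K" if "\<chi> \<in> ?K" "\<psi> \<in> ?K" for \<chi> \<psi>
    using closed(2) closed_R that by (auto simp: characters_def)
  have coord: "(\<lambda>r\<in>R. \<phi> r i) \<in> ?K" "(\<lambda>r\<in>R. inverse (\<phi> r i)) \<in> ?K" if "i < n" for i
  proof -
    have "restrict (\<lambda>t. t i) ?T \<in> split_torus_regular n"
      "restrict (\<lambda>t. inverse (t i)) ?T \<in> split_torus_regular n"
      using that by (auto simp: split_torus_regular_def intro!: gen_algebra.gen)
    then have "(\<lambda>r\<in>R. restrict (\<lambda>t. t i) ?T (\<phi> r)) \<in> restr_regular A R"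
      "(\<lambda>r\<in>R. restrict (\<lambda>t. inverse (t i)) ?T (\<phi> r)) \<in> restr_regular A R"
      using reg unfolding regular_map_def by blast+
    moreover have "(\<lambda>r\<in>R. restrict (\<lambda>t. t i) ?T (\<phi> r)) = (\<lambda>r\<in>R. \<phi> r i)"
      "(\<lambda>r\<in>R. restrict (\<lambda>t. inverse (t i)) ?T (\<phi> r)) = (\<lambda>r\<in>R. inverse (\<phi> r i))"
      using \<phi>T by (auto simp: restrict_def)
    ultimately show "(\<lambda>r\<in>R. \<phi> r i) \<in> ?K" "(\<lambda>r\<in>R. inverse (\<phi> r i)) \<in> ?K"
      using closed_R nz that hom by (auto simp: characters_def)
  qed
  have pull: "character_sum (*) R ?K (\<lambda>r. h (\<phi> r))" if "h \<in> split_torus_regular n" for h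
    using that unfolding split_torus_regular_def
  proof induction
    case (const c)
    show ?case
      by (rule character_sum_eqI[OF character_sum_single[OF one, of R c]]) (simp add: \<phi>T)
  next
    case (gen f)
    then consider i where "i < n" "f = (\<lambda>t. t i)" | i where "i < n" "f = (\<lambda>t. inverse (t i))"
      by auto
    then show ?case
    proof cases
      case 1
      show ?thesis
        by (rule character_sum_eqI[OF character_sum_single[OF coord(1)[OF 1(1)], of R 1]])
          (simp add: \<phi>T 1(2))
    next
      case 2
      show ?thesis
        by (rule character_sum_eqI[OF character_sum_single[OF coord(2)[OF 2(1)], of R 1]])
          (simp add: \<phi>T 2(2))
    qed
  next
    case (add f g)
    show ?case
      by (rule character_sum_eqI[OF character_sum_add[OF add.IH]]) (simp add: \<phi>T)
  next
    case (mult f g)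
    show ?case
      by (rule character_sum_eqI[OF character_sum_mult[OF mult.IH prod]]) (simp_all add: \<phi>T)
  qed
  have "(\<lambda>t\<in>?T. f (inv_into R \<phi> t)) \<in> split_torus_regular n"
    using reg' f by (auto simp: regular_map_def)
  show ?thesis
    by (rule character_sum_eqI[OF pull[OF \<open>_ \<in> split_torus_regular n\<close>]])
      (use bij \<phi>T in \<open>auto simp: bij_betw_def inv_into_f_f\<close>)
qed

section \<open>Weight decompositions\<close>

locale torus_representation = vector_space scale
  for G :: "('g, 'm) monoid_scheme"
    and A :: "('g \<Rightarrow> 'k::field) set"
    and scale :: "'k \<Rightarrow> 'v::ab_group_add \<Rightarrow> 'v"
    and \<rho> :: "'g \<Rightarrow> 'v \<Rightarrow> 'v"
    and R :: "'g set" +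
  assumes group: "linear_algebraic_group G A"
    and rep: "rational_representation G A scale \<rho>"
    and torus: "torus_of G A R"
begin

sublocale endo: vector_space_pair scale scale by unfold_locales

abbreviation "K \<equiv> characters G A R"

lemma R_subgroup: "subgroup R G" and R_subset: "R \<subseteq> carrier G"
  using torus by (auto simp: torus_of_def subgroup.subset subgroup.mem_carrier)

lemma one_R: "\<one>\<^bsub>G\<^esub> \<in> R" and mult_R: "\<And>r s. r \<in> R \<Longrightarrow> s \<in> R \<Longrightarrow> r \<otimes>\<^bsub>G\<^esub> s \<in> R"
  using R_subgroup by (auto simp: subgroup.one_closed subgroup.m_closed)

lemma linear_\<rho>: "g \<in> carrier G \<Longrightarrow> Vector_Spaces.linear scale scale (\<rho> g)"
  using rep by (simp add: rational_representation_def)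

lemmas \<rho>_add = endo.linear_add[OF linear_\<rho>]
  and \<rho>_scale = endo.linear_scale[OF linear_\<rho>]
  and \<rho>_sum = endo.linear_sum[OF linear_\<rho>]
  and \<rho>_diff = endo.linear_diff[OF linear_\<rho>]

lemma character_mult: "\<chi> \<in> K \<Longrightarrow> r \<in> R \<Longrightarrow> s \<in> R \<Longrightarrow> \<chi> (r \<otimes>\<^bsub>G\<^esub> s) = \<chi> r * \<chi> s"
  and character_nonzero: "\<chi> \<in> K \<Longrightarrow> r \<in> R \<Longrightarrow> \<chi> r \<noteq> 0"
  by (simp_all add: characters_def)

lemma character_one:
  assumes "\<chi> \<in> K"
  shows "\<chi> \<one>\<^bsub>G\<^esub> = 1"
proof -
  have "\<one>\<^bsub>G\<^esub> \<otimes>\<^bsub>G\<^esub> \<one>\<^bsub>G\<^esub> = \<one>\<^bsub>G\<^esub>"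
    using group by (simp add: linear_algebraic_group_def group.is_monoid monoid.r_one monoid.one_closed)
  then show ?thesis
    using character_mult[OF assms one_R one_R] character_nonzero[OF assms one_R] by simp
qed

lemma characters_eqI:
  assumes "\<chi> \<in> K" "\<psi> \<in> K" "\<And>r. r \<in> R \<Longrightarrow> \<chi> r = \<psi> r"
  shows "\<chi> = \<psi>"
proof (rule extensionalityI)
  show "\<chi> \<in> extensional R" "\<psi> \<in> extensional R"
    using assms(1,2) by (auto simp: characters_def restr_regular_def)
qed (rule assms(3))

text \<open>
  Dedekind's argument, with vectors as coefficients: subtracting \<open>\<psi> s\<close> times the relation from its
  translate by \<open>s\<close> eliminates \<open>\<psi>\<close> and multiplies the coefficient of \<open>\<chi>\<close> by \<open>\<chi> s - \<psi> s\<close>, which is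
  nonzero for a suitable \<open>s\<close>.
\<close>

lemma characters_independent:
  assumes "finite C" "C \<subseteq> K" "\<And>r. r \<in> R \<Longrightarrow> (\<Sum>\<chi>\<in>C. scale (\<chi> r) (w \<chi>)) = 0" "\<chi> \<in> C"
  shows "w \<chi> = 0"
  using assms
proof (induction C arbitrary: w \<chi> rule: finite_induct)
  case (insert \<psi> C)
  have rel: "scale (\<psi> r) (w \<psi>) + (\<Sum>\<chi>\<in>C. scale (\<chi> r) (w \<chi>)) = 0" if "r \<in> R" for r
    using insert.prems(2)[OF that] insert.hyps by simp
  have zero: "w \<chi> = 0" if "\<chi> \<in> C" for \<chi>
  proof -
    have "\<chi> \<noteq> \<psi>" using that insert.hyps(2) by auto
    moreover have "\<chi> \<in> K" "\<psi> \<in> K" using insert.prems(1) that by auto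
    ultimately have "\<not> (\<forall>r\<in>R. \<chi> r = \<psi> r)"
      using characters_eqI[of \<chi> \<psi>] by blast
    then obtain s where s: "s \<in> R" "\<chi> s \<noteq> \<psi> s" by auto
    have "(\<Sum>\<chi>\<in>C. scale (\<chi> r) (scale (\<chi> s - \<psi> s) (w \<chi>))) = 0" if r: "r \<in> R" for r
    proof -
      have char: "\<chi> (r \<otimes>\<^bsub>G\<^esub> s) = \<chi> s * \<chi> r" if "\<chi> \<in> insert \<psi> C" for \<chi>
        by (subst character_mult[OF _ r s(1)]) (use that insert.prems(1) in \<open>auto simp: mult.commute\<close>)
      have "(\<Sum>\<chi>\<in>C. scale (\<chi> r) (scale (\<chi> s - \<psi> s) (w \<chi>)))
          = (\<Sum>\<chi>\<in>C. scale (\<chi> (r \<otimes>\<^bsub>G\<^esub> s)) (w \<chi>) - scale (\<psi> s) (scale (\<chi> r) (w \<chi>)))"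
      proof (rule sum.cong[OF refl])
        fix \<chi> assume "\<chi> \<in> C"
        then show "scale (\<chi> r) (scale (\<chi> s - \<psi> s) (w \<chi>))
            = scale (\<chi> (r \<otimes>\<^bsub>G\<^esub> s)) (w \<chi>) - scale (\<psi> s) (scale (\<chi> r) (w \<chi>))"
          by (simp add: char scale_left_diff_distrib scale_right_diff_distrib mult.commute)
      qed
      also have "\<dots> = (\<Sum>\<chi>\<in>C. scale (\<chi> (r \<otimes>\<^bsub>G\<^esub> s)) (w \<chi>))
          - scale (\<psi> s) (\<Sum>\<chi>\<in>C. scale (\<chi> r) (w \<chi>))"
        by (simp only: sum_subtractf scale_sum_right)
      also have "(\<Sum>\<chi>\<in>C. scale (\<chi> (r \<otimes>\<^bsub>G\<^esub> s)) (w \<chi>)) = - scale (\<psi> s) (scale (\<psi> r) (w \<psi>))"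
        using rel[OF mult_R[OF r s(1)]] by (simp add: char add_eq_0_iff)
      also have "(\<Sum>\<chi>\<in>C. scale (\<chi> r) (w \<chi>)) = - scale (\<psi> r) (w \<psi>)"
        using rel[OF r] by (simp add: add_eq_0_iff)
      finally show ?thesis by simp
    qed
    then have "scale (\<chi> s - \<psi> s) (w \<chi>) = 0"
      using insert.IH[of "\<lambda>\<chi>. scale (\<chi> s - \<psi> s) (w \<chi>)" \<chi>] insert.prems(1) that by auto
    then show ?thesis using s(2) by simp
  qed
  then have "scale (\<psi> \<one>\<^bsub>G\<^esub>) (w \<psi>) = 0"
    using rel[OF one_R] by simp
  then have "w \<psi> = 0"
    using character_one[of \<psi>] insert.prems(1) by simp
  with zero insert.prems(3) show ?case by auto
qed simp

abbreviation "decomposes \<equiv> weight_decomposition G A scale \<rho> R"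

lemma decomposes_eq_sum:
  assumes "decomposes u c" "finite C" "{\<chi>. c \<chi> \<noteq> 0} \<subseteq> C"
  shows "u = sum c C"
  using assms unfolding weight_decomposition_def
  by (auto intro!: sum.mono_neutral_left)

lemma decomposesI:
  assumes "\<And>\<chi>. \<chi> \<in> C \<Longrightarrow> \<chi> \<in> K" "\<And>\<chi>. \<chi> \<in> C \<Longrightarrow> c \<chi> \<in> weight_space scale \<rho> R \<chi>"
    and "\<And>\<chi>. \<chi> \<notin> C \<Longrightarrow> c \<chi> = 0" "finite C" "u = sum c C"
  shows "decomposes u c"
proof -
  have z: "0 \<in> weight_space scale \<rho> R \<chi>" for \<chi>
    using R_subset endo.linear_0[OF linear_\<rho>] by (auto simp: weight_space_def)
  have "{\<chi>. c \<chi> \<noteq> 0} \<subseteq> C" using assms(3) by auto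
  moreover from this have "u = (\<Sum>\<chi> | c \<chi> \<noteq> 0. c \<chi>)"
    using assms(4,5) by (auto intro!: sum.mono_neutral_right)
  ultimately show ?thesis
    unfolding weight_decomposition_def
    using assms(1-4) z finite_subset by (metis (no_types, lifting))
qed

text \<open>
  Applying \<open>\<rho> r\<close> to a relation between weight vectors multiplies each by \<open>\<chi> r\<close>, which gives a relation
  between characters.
\<close>

lemma decomposes_unique:
  assumes c: "decomposes u c" and d: "decomposes u d"
  shows "c = d"
proof
  fix \<chi>
  define C where "C = {\<chi>. c \<chi> \<noteq> 0} \<union> {\<chi>. d \<chi> \<noteq> 0}"
  have C: "finite C" "C \<subseteq> K"
    using c d by (auto simp: C_def weight_decomposition_def)
  have "(\<Sum>\<chi>\<in>C. scale (\<chi> r) (c \<chi> - d \<chi>)) = 0" if r: "r \<in> R" for r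
  proof -
    have g: "r \<in> carrier G" using R_subset r by auto
    have "\<rho> r (c \<chi> - d \<chi>) = scale (\<chi> r) (c \<chi> - d \<chi>)" if "\<chi> \<in> C" for \<chi>
      using that C(2) c d r g
      by (auto simp: weight_decomposition_def weight_space_def \<rho>_diff scale_right_diff_distrib)
    then have "(\<Sum>\<chi>\<in>C. scale (\<chi> r) (c \<chi> - d \<chi>)) = \<rho> r (\<Sum>\<chi>\<in>C. c \<chi> - d \<chi>)"
      using g by (simp add: \<rho>_sum)
    also have "(\<Sum>\<chi>\<in>C. c \<chi> - d \<chi>) = u - u"
      using decomposes_eq_sum[OF c C(1)] decomposes_eq_sum[OF d C(1)]
      by (simp add: C_def sum_subtractf)
    finally show ?thesis using endo.linear_0[OF linear_\<rho>[OF g]] by simp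
  qed
  from characters_independent[OF C this] show "c \<chi> = d \<chi>"
    by (cases "\<chi> \<in> C") (auto simp: C_def)
qed

lemma finite_basis_exists: "\<exists>B. finite B \<and> independent B \<and> span B = UNIV"
proof -
  obtain S where S: "finite S" "span S = UNIV"
    using rep by (auto simp: rational_representation_def)
  obtain B where "B \<subseteq> S" "independent B" "S \<subseteq> span B"
    using maximal_independent_subset by blast
  with S show ?thesis
    by (metis finite_subset span_minimal subspace_span top.extremum_unique)
qed

definition "basis = (SOME B. finite B \<and> independent B \<and> span B = UNIV)"

lemma finite_basis: "finite basis" and independent_basis: "independent basis"
  and span_basis: "span basis = UNIV"
  using someI_ex[OF finite_basis_exists] by (auto simp: basis_def)

abbreviation "coord u b \<equiv> representation basis u b"

lemma sum_coord: "(\<Sum>b\<in>basis. scale (coord u b) b) = u"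
proof -
  have "(\<Sum>b\<in>basis. scale (coord u b) b) = (\<Sum>b | coord u b \<noteq> 0. scale (coord u b) b)"
    using finite_basis representation_ne_zero[of basis u]
    by (intro sum.mono_neutral_right) auto
  then show ?thesis
    using sum_nonzero_representation_eq[OF independent_basis, of u] span_basis by simp
qed

lemma linear_coord: "Vector_Spaces.linear scale (*) (\<lambda>u. coord u b)"
  unfolding Vector_Spaces.linear_iff
  using representation_add[OF independent_basis] representation_scale[OF independent_basis]
  by (simp add: vector_space_axioms vector_space_field span_basis)

lemma matrix_coefficient_regular:
  "Vector_Spaces.linear scale (*) l \<Longrightarrow> (\<lambda>g\<in>carrier G. l (\<rho> g u)) \<in> A"
  using rep by (simp add: rational_representation_def)

lemma orbit_character_sum: "character_sum scale R K (\<lambda>r. \<rho> r u)"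
proof -
  have "character_sum scale R K (\<lambda>r. scale (coord (\<rho> r u) b) b)" for b
  proof -
    have "restrict (\<lambda>g\<in>carrier G. coord (\<rho> g u) b) R \<in> restr_regular A R"
      unfolding restr_regular_def by (rule imageI[OF matrix_coefficient_regular[OF linear_coord]])
    from torus_regular_character_sum[OF group torus this]
    obtain C a where C: "finite C" "C \<subseteq> K" "\<And>r. r \<in> R \<Longrightarrow> coord (\<rho> r u) b = (\<Sum>\<chi>\<in>C. \<chi> r * a \<chi>)"
      using R_subset unfolding character_sum_def by (auto simp: subset_iff)
    show ?thesis
      unfolding character_sum_def
      by (intro exI[of _ C] exI[of _ "\<lambda>\<chi>. scale (a \<chi>) b"]) (use C in \<open>auto simp: scale_sum_left\<close>)
  qed
  from character_sum_sum[of basis R K "\<lambda>b r. scale (coord (\<rho> r u) b) b", OF this] show ?thesis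
    by (simp add: sum_coord)
qed

text \<open>
  The orbit map is a sum of characters with coefficients \<open>w\<close>. As functions of \<open>r\<close>, the two sides of
  \<open>\<rho> (s \<otimes> r) u = \<rho> s (\<rho> r u)\<close> are sums of characters in which \<open>\<chi>\<close> has the coefficients
  \<open>\<chi> s\<close> times \<open>w \<chi>\<close> and \<open>\<rho> s (w \<chi>)\<close>, so independence makes each \<open>w \<chi>\<close> a weight vector. At the unit
  the sum of the \<open>w \<chi>\<close> is \<open>u\<close>.
\<close>

lemma decomposes_exists: "\<exists>c. decomposes u c"
proof -
  obtain C w where C: "finite C" "C \<subseteq> K" "\<And>r. r \<in> R \<Longrightarrow> \<rho> r u = (\<Sum>\<chi>\<in>C. scale (\<chi> r) (w \<chi>))"
    using orbit_character_sum[of u] unfolding character_sum_def by (elim exE conjE) simp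
  have w: "\<rho> s (w \<chi>) = scale (\<chi> s) (w \<chi>)" if "\<chi> \<in> C" "s \<in> R" for \<chi> s
  proof -
    have g: "s \<in> carrier G" using R_subset that by auto
    have "(\<Sum>\<chi>\<in>C. scale (\<chi> r) (\<rho> s (w \<chi>) - scale (\<chi> s) (w \<chi>))) = 0" if r: "r \<in> R" for r
    proof -
      have "\<rho> (s \<otimes>\<^bsub>G\<^esub> r) u = \<rho> s (\<rho> r u)"
        using rep g r R_subset by (auto simp: rational_representation_def)
      then have "(\<Sum>\<chi>\<in>C. scale (\<chi> (s \<otimes>\<^bsub>G\<^esub> r)) (w \<chi>)) = \<rho> s (\<Sum>\<chi>\<in>C. scale (\<chi> r) (w \<chi>))"
        using C(3) mult_R[OF \<open>s \<in> R\<close> r] r by simp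
      moreover have "(\<Sum>\<chi>\<in>C. scale (\<chi> (s \<otimes>\<^bsub>G\<^esub> r)) (w \<chi>)) = (\<Sum>\<chi>\<in>C. scale (\<chi> r) (scale (\<chi> s) (w \<chi>)))"
        using C(2) r \<open>s \<in> R\<close> by (intro sum.cong) (auto simp: character_mult subset_iff mult.commute)
      ultimately show ?thesis
        using g by (simp add: \<rho>_sum \<rho>_scale scale_right_diff_distrib sum_subtractf)
    qed
    from characters_independent[OF C(1,2) this that(1)] show ?thesis by simp
  qed
  have "u = \<rho> \<one>\<^bsub>G\<^esub> u" using rep by (simp add: rational_representation_def)
  also have "\<dots> = (\<Sum>\<chi>\<in>C. w \<chi>)"
    using C(2) by (auto simp: C(3)[OF one_R] character_one intro!: sum.cong)
  finally have "decomposes u (\<lambda>\<chi>. if \<chi> \<in> C then w \<chi> else 0)"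
    using C w by (intro decomposesI[of C]) (auto simp: weight_space_def)
  then show ?thesis by blast
qed

abbreviation "component \<equiv> weight_component G A scale \<rho> R"

lemma decomposes_component: "decomposes u (component u)"
  unfolding weight_component_def
  using decomposes_exists decomposes_unique by (metis theI)

lemma component_eqI: "decomposes u c \<Longrightarrow> component u = c"
  using decomposes_component decomposes_unique by blast

lemma component_nonzero_character: "component u \<chi> \<noteq> 0 \<Longrightarrow> \<chi> \<in> K"
  and finite_component_support: "finite {\<chi>. component u \<chi> \<noteq> 0}"
  and component_weight: "\<chi> \<in> K \<Longrightarrow> component u \<chi> \<in> weight_space scale \<rho> R \<chi>"
  using decomposes_component[of u] by (auto simp: weight_decomposition_def)

text \<open>
  Componentwise sums and multiples of decompositions are decompositions, so this is a consequence of
  uniqueness.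
\<close>

lemma linear_component: "Vector_Spaces.linear scale scale (\<lambda>u. component u \<chi>)"
  unfolding Vector_Spaces.linear_iff
proof (intro conjI allI vector_space_axioms)
  fix u v
  have "decomposes (u + v) (\<lambda>\<chi>. component u \<chi> + component v \<chi>)"
  proof (rule decomposesI)
    let ?C = "{\<chi>. component u \<chi> \<noteq> 0} \<union> {\<chi>. component v \<chi> \<noteq> 0}"
    show "finite ?C" by (simp add: finite_component_support)
    show "u + v = (\<Sum>\<chi>\<in>?C. component u \<chi> + component v \<chi>)"
      using decomposes_eq_sum[OF decomposes_component \<open>finite ?C\<close>, of u]
        decomposes_eq_sum[OF decomposes_component \<open>finite ?C\<close>, of v]
      by (simp add: sum.distrib)
    show "component u \<chi> + component v \<chi> \<in> weight_space scale \<rho> R \<chi>" if "\<chi> \<in> ?C" for \<chi>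
    proof -
      have "\<chi> \<in> K" using that component_nonzero_character by auto
      then show ?thesis
        using component_weight[of \<chi> u] component_weight[of \<chi> v] R_subset
        by (auto simp: weight_space_def \<rho>_add subset_iff scale_right_distrib)
    qed
  qed (auto dest: component_nonzero_character)
  from component_eqI[OF this] show "component (u + v) \<chi> = component u \<chi> + component v \<chi>"
    by simp
next
  fix a u
  have "decomposes (scale a u) (\<lambda>\<chi>. scale a (component u \<chi>))"
  proof (rule decomposesI)
    let ?C = "{\<chi>. component u \<chi> \<noteq> 0}"
    show "finite ?C" by (simp add: finite_component_support)
    show "scale a u = (\<Sum>\<chi>\<in>?C. scale a (component u \<chi>))"
      using decomposes_eq_sum[OF decomposes_component \<open>finite ?C\<close>, of u]
      by (simp add: scale_sum_right[symmetric])
    show "scale a (component u \<chi>) \<in> weight_space scale \<rho> R \<chi>" if "\<chi> \<in> ?C" for \<chi>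
      using that component_weight[of \<chi> u] component_nonzero_character[of u \<chi>] R_subset
      by (auto simp: weight_space_def \<rho>_scale subset_iff scale_left_commute)
  qed (auto dest: component_nonzero_character)
  from component_eqI[OF this] show "component (scale a u) \<chi> = scale a (component u \<chi>)"
    by simp
qed

lemma component_weight_vector:
  assumes "\<chi> \<in> K" "u \<in> weight_space scale \<rho> R \<chi>"
  shows "component u \<chi> = u"
proof -
  have "decomposes u (\<lambda>\<psi>. if \<psi> = \<chi> then u else 0)"
    using assms by (intro decomposesI[of "{\<chi>}"]) auto
  from component_eqI[OF this] show ?thesis by simp
qed

abbreviation "P \<equiv> weights G A scale \<rho> R"

text \<open>
  The projection to a weight space is linear and fixes a nonzero weight vector there, so it cannot
  vanish on the whole finite basis.
\<close>

lemma finite_weights: "finite P"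
proof (rule finite_subset)
  show "finite (\<Union>b\<in>basis. {\<chi>. component b \<chi> \<noteq> 0})"
    by (simp add: finite_basis finite_component_support)
  show "P \<subseteq> (\<Union>b\<in>basis. {\<chi>. component b \<chi> \<noteq> 0})"
  proof
    fix \<chi> assume "\<chi> \<in> P"
    moreover have "0 \<in> weight_space scale \<rho> R \<chi>"
      using R_subset endo.linear_0[OF linear_\<rho>] by (auto simp: weight_space_def)
    ultimately obtain u where u: "\<chi> \<in> K" "u \<in> weight_space scale \<rho> R \<chi>" "u \<noteq> 0"
      by (auto simp: weights_def)
    have "u = component (\<Sum>b\<in>basis. scale (coord u b) b) \<chi>"
      using component_weight_vector[OF u(1,2)] by (simp add: sum_coord)
    also have "\<dots> = (\<Sum>b\<in>basis. scale (coord u b) (component b \<chi>))"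
      by (simp add: endo.linear_sum[OF linear_component] endo.linear_scale[OF linear_component])
    finally show "\<chi> \<in> (\<Union>b\<in>basis. {\<chi>. component b \<chi> \<noteq> 0})"
      using u(3) by (auto intro: ccontr)
  qed
qed

lemma state_eq: "state G A scale \<rho> R u = {\<chi>. component u \<chi> \<noteq> 0}"
  using component_nonzero_character by (auto simp: state_def)

lemma state_subset_weights: "state G A scale \<rho> R u \<subseteq> P"
  using component_nonzero_character component_weight by (fastforce simp: state_eq weights_def)

text \<open>
  A vector is nonzero when some coordinate is, and the coordinates of the component of \<open>\<rho> g v\<close> are
  matrix coefficients.
\<close>

lemma openin_component_nonzero:
  "openin (zariski (carrier G) A) {g \<in> carrier G. component (\<rho> g v) \<chi> \<noteq> 0}"
proof -
  have aff: "affine_variety (carrier G) A" using group by (simp add: linear_algebraic_group_def)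
  let ?f = "\<lambda>b. \<lambda>g\<in>carrier G. coord (component (\<rho> g v) \<chi>) b"
  have "?f b \<in> A" for b
    using Vector_Spaces.linear_compose[OF linear_component[of \<chi>] linear_coord[of b]]
    by (intro matrix_coefficient_regular) (simp add: o_def)
  moreover have "(\<exists>b. coord u b \<noteq> 0) \<longleftrightarrow> u \<noteq> 0" for u
    using sum_coord[of u] representation_zero[of basis] by (metis (no_types, lifting) scale_zero_left sum.neutral)
  ultimately show ?thesis
    unfolding openin_zariski[OF aff] by (intro exI[of _ "range ?f"]) auto
qed

end

section \<open>The stratification by states\<close>

theorem proposition2p2:
  fixes G :: "('g, 'm) monoid_scheme"
    and A :: "('g \<Rightarrow> 'k::{alg_closed_field, field_char_0}) set"
    and scale :: "'k \<Rightarrow> 'v::ab_group_add \<Rightarrow> 'v"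
    and \<rho> :: "'g \<Rightarrow> 'v \<Rightarrow> 'v"
    and R :: "'g set"
    and v :: 'v
  assumes "linear_algebraic_group G A"
    and "connected_space (zariski (carrier G) A)"
    and "rational_representation G A scale \<rho>"
    and "torus_of G A R"
  shows "\<exists>U :: ('g \<Rightarrow> 'k) set \<Rightarrow> 'g set.
      (\<forall>S \<in> Pow (weights G A scale \<rho> R). locally_closedin (zariski (carrier G) A) (U S)) \<and>
      disjoint_family_on U (Pow (weights G A scale \<rho> R)) \<and>
      carrier G = (\<Union>S \<in> Pow (weights G A scale \<rho> R). U S) \<and>
      (\<forall>g \<in> carrier G. \<forall>g' \<in> carrier G.
         state G A scale \<rho> R (\<rho> g v) = state G A scale \<rho> R (\<rho> g' v) \<longleftrightarrow>
         (\<exists>S \<in> Pow (weights G A scale \<rho> R). g \<in> U S \<and> g' \<in> U S)) \<and>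
      (\<exists>Sv \<in> Pow (weights G A scale \<rho> R).
         openin (zariski (carrier G) A) (U Sv) \<and>
         zariski (carrier G) A closure_of (U Sv) = carrier G)"
proof -
  interpret torus_representation G A scale \<rho> R
    using assms by (auto simp: torus_representation_def torus_representation_axioms_def
        rational_representation_def)
  let ?T = "zariski (carrier G) A"
  have aff: "affine_variety (carrier G) A" using assms(1) by (simp add: linear_algebraic_group_def)
  have top: "topspace ?T = carrier G" by (rule topspace_zariski[OF aff])
  have one: "\<one>\<^bsub>G\<^esub> \<in> carrier G" using one_R R_subset by auto
  define state_of where "state_of g = state G A scale \<rho> R (\<rho> g v)" for g
  define D where "D \<chi> = {g \<in> carrier G. \<chi> \<in> state_of g}" for \<chi>
  define U where "U S = {g \<in> carrier G. state_of g = S}" for S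
  have state_P: "state_of g \<subseteq> P" for g
    unfolding state_of_def by (rule state_subset_weights)
  have open_D: "openin ?T (D \<chi>)" for \<chi>
    using openin_component_nonzero[of v \<chi>] by (simp add: D_def state_of_def state_eq)
  have open_DS: "openin ?T (carrier G \<inter> (\<Inter>\<chi>\<in>S. D \<chi>))" if "S \<subseteq> P" for S
    using finite_subset[OF that finite_weights] open_D openin_topspace[of ?T] top
    by (induction S rule: finite_induct) (auto simp: Int_left_commute[of "carrier G"])
  have locally_closed: "locally_closedin ?T (U S)" if "S \<subseteq> P" for S
    unfolding locally_closedin_def
  proof (intro exI conjI)
    show "openin ?T (carrier G \<inter> (\<Inter>\<chi>\<in>S. D \<chi>))" by (rule open_DS[OF that])
    show "closedin ?T (carrier G - (\<Union>\<chi>\<in>P - S. D \<chi>))"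
      using open_D top by (metis (no_types, lifting) closedin_diff closedin_topspace imageE openin_Union)
    show "U S = (carrier G - (\<Union>\<chi>\<in>P - S. D \<chi>)) \<inter> (carrier G \<inter> (\<Inter>\<chi>\<in>S. D \<chi>))"
      using state_P by (auto simp: U_def D_def)
  qed
  define Sv where "Sv = {\<chi> \<in> P. D \<chi> \<noteq> {}}"
  have Sv: "finite Sv" "Sv \<subseteq> P"
    using finite_weights by (auto simp: Sv_def)
  have U_Sv: "U Sv = carrier G \<inter> (\<Inter>\<chi>\<in>Sv. D \<chi>)"
    using state_P by (auto simp: U_def D_def Sv_def)
  have open_Sv: "openin ?T (U Sv)" unfolding U_Sv by (rule open_DS[OF Sv(2)])
  have dense: "?T closure_of W = carrier G" if "openin ?T W" "W \<noteq> {}" for W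
    by (rule connected_group_open_dense[OF assms(1,2) that])
  \<comment> \<open>Each \<open>D \<chi>\<close> with \<open>\<chi> \<in> Sv\<close> meets the intersection of the previous ones, which is dense.\<close>
  have "C \<subseteq> Sv \<Longrightarrow> carrier G \<inter> (\<Inter>\<chi>\<in>C. D \<chi>) \<noteq> {}" if "finite C" for C
    using that
  proof induction
    case empty
    then show ?case using one by auto
  next
    case (insert \<chi> C)
    let ?W = "carrier G \<inter> (\<Inter>\<chi>\<in>C. D \<chi>)"
    obtain g where "g \<in> D \<chi>" using insert.prems by (auto simp: Sv_def)
    moreover have "g \<in> ?T closure_of ?W"
      using dense[of ?W] open_DS[of C] insert Sv(2) \<open>g \<in> D \<chi>\<close> by (auto simp: D_def)
    ultimately have "\<exists>y. y \<in> ?W \<and> y \<in> D \<chi>"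
      using open_D[of \<chi>] by (simp add: in_closure_of)
    then show ?case by auto
  qed
  from this[OF Sv(1)] have "U Sv \<noteq> {}"
    using U_Sv by simp
  have "openin ?T (U Sv) \<and> ?T closure_of (U Sv) = carrier G"
    using open_Sv dense[OF open_Sv \<open>U Sv \<noteq> {}\<close>] by simp
  moreover have "disjoint_family_on U (Pow P)"
    by (auto simp: disjoint_family_on_def U_def)
  moreover have "carrier G = (\<Union>S\<in>Pow P. U S)"
    using state_P by (auto simp: U_def)
  moreover have "state_of g = state_of g' \<longleftrightarrow> (\<exists>S\<in>Pow P. g \<in> U S \<and> g' \<in> U S)"
    if "g \<in> carrier G" "g' \<in> carrier G" for g g'
    using that state_P by (auto simp: U_def)
  ultimately show ?thesis
    using locally_closed Sv(2) unfolding state_of_def[symmetric]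
    by (intro exI[of _ U] conjI) auto
qed

end
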